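(* Let $r\geq 2$ and $n>r^{8}$. Every graph $G$ of order $n$ with $e(G)\geq t_r(n)$ that is not isomorphic to $T_r(n)$ satisfies $$js^{(2,r+1,2)}(G)>\frac{n^{r-1}}{r^{r+5}}.$$
   Context: All graphs are finite and simple; $e(G)$ is the number of edges. $T_r(n)$ denotes the Turán graph: the complete $r$-partite graph on $n$ vertices whose $r$ parts have sizes as equal as possible; $t_r(n)=e(T_r(n))$. For an integer $r\geq 2$, $js^{(2,r+1,2)}(G)$ is the maximum, over all edges $uv$ of $G$, of the number of $(r+1)$-cliques of $G$ containing both $u$ and $v$ (and $0$ if $G$ has no edges). *)

theory Defs
  imports Complex_Main
begin

definition simple_graph :: "'a set \<Rightarrow> 'a set set \<Rightarrow> bool" where
  "simple_graph V E \<longleftrightarrow> finite V \<and>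
     (\<forall>e\<in>E. \<exists>u v. u \<noteq> v \<and> u \<in> V \<and> v \<in> V \<and> e = {u, v})"

text \<open>Turan graph T_r(n) on vertex set {0..<n}: vertex i lies in part (i mod r);
  parts have sizes as equal as possible; edges join vertices in different parts.\<close>
definition turan_edges :: "nat \<Rightarrow> nat \<Rightarrow> nat set set" where
  "turan_edges r n = {{i, j} | i j. i < n \<and> j < n \<and> i mod r \<noteq> j mod r}"

definition turan_number :: "nat \<Rightarrow> nat \<Rightarrow> nat" where
  "turan_number r n = card (turan_edges r n)"

definition graph_iso :: "'a set \<Rightarrow> 'a set set \<Rightarrow> 'b set \<Rightarrow> 'b set set \<Rightarrow> bool" where
  "graph_iso V E V' E' \<longleftrightarrow> (\<exists>f. bij_betw f V V' \<and>
     (\<forall>u\<in>V. \<forall>v\<in>V. {u, v} \<in> E \<longleftrightarrow> {f u, f v} \<in> E'))"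

definition is_clique :: "'a set set \<Rightarrow> 'a set \<Rightarrow> bool" where
  "is_clique E K \<longleftrightarrow> (\<forall>u\<in>K. \<forall>v\<in>K. u \<noteq> v \<longrightarrow> {u, v} \<in> E)"

definition cliques_containing :: "'a set \<Rightarrow> 'a set set \<Rightarrow> nat \<Rightarrow> 'a set \<Rightarrow> nat" where
  "cliques_containing V E k S = card {K. K \<subseteq> V \<and> card K = k \<and> S \<subseteq> K \<and> is_clique E K}"

definition js_edge :: "'a set \<Rightarrow> 'a set set \<Rightarrow> nat \<Rightarrow> nat" where
  "js_edge V E r = (if E = {} then 0 else Max ((\<lambda>e. cliques_containing V E (r + 1) e) ` E))"

end

theory Submission
  imports Defs
begin

text \<open>
  Delete vertices of degree below \<open>(1 - 1/r - 1/r^4) m\<close>, where \<open>m\<close> is the current order, at most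
  \<open>n/r\<close> times. Each deletion raises the excess of the number of edges over \<open>(1 - 1/r) m^2 / 2\<close>.

  If the process stops, the remaining graph contains a \<open>K_{r+1}\<close>: after at least one deletion
  because of its positive excess, and without deletion by the uniqueness in Turan's theorem.
  By convexity some edge of this clique has a common neighbourhood noticeably larger than
  \<open>(1 - 2/r) m\<close>, and by the minimum degree it extends greedily to many \<open>(r+1)\<close>-cliques.

  Otherwise the remaining graph has at least \<open>(1 - 1/r + 1/(2 r^5)) m^2 / 2\<close> edges, and the
  Moon--Moser inequalities bound the average number of \<open>(r+1)\<close>-cliques on an edge.
\<close>

text \<open>The hypothesis on the number of edges does not make the excess positive:
  \<open>2 * t_r(n)\<close> can lie below \<open>(1 - 1/r) n^2\<close> by as much as
  \<open>r/4\<close>. Hence an undeleted graph cannot get its \<open>K_{r+1}\<close> from an edge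
  count alone, while \<open>n > r^8\<close> makes the gain of a single deletion, at least
  \<open>n/r^4 - 1\<close>, larger than \<open>r/4\<close>. The threshold \<open>1/r^4\<close>
  answers two opposite demands. In the minimum degree case some edge of the clique has a common
  neighbourhood with surplus density \<open>2/(r^2 (r+1))\<close>, up to a multiple of
  \<open>1/r^4\<close>; all losses due to the threshold together stay below
  \<open>r * (1/r^4) = 1/r^3\<close>, which is less than that surplus. In the other case
  \<open>n/r\<close> deletions gain about \<open>n/r^4\<close> each, so the final excess is about
  \<open>n^2/r^5\<close>, and half of it is kept as surplus density. At least
  \<open>(1 - 1/r) n\<close> vertices always survive, which costs only a factor \<open>r\<close> in
  the power \<open>n^(r-1)\<close>. The resulting denominators are \<open>r^(r+2) (r+1)\<close> and
  \<open>2 (r-1) r^(r+3)\<close>, both below \<open>r^(r+5)\<close>.\<close>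

section \<open>Double counting and numerical inequalities\<close>

lemma sum_card_swap:
  assumes "finite A" "finite B"
  shows "(\<Sum>a\<in>A. real (card {b \<in> B. P a b})) = (\<Sum>b\<in>B. real (card {a \<in> A. P a b}))"
  using sum_multicount_gen[of A B "P" "\<lambda>b. card {a \<in> A. P a b}"] assms
  by (simp flip: of_nat_sum)

lemma real_choose_two: "real (n choose 2) = real n * (real n - 1) / 2"
proof (cases n)
  case (Suc k)
  have "even (n * (n - 1))" by auto
  then have "2 * (n choose 2) = n * (n - 1)" unfolding choose_two by (rule dvd_mult_div_cancel)
  then have "2 * real (n choose 2) = real n * real (n - 1)"
    by (metis of_nat_mult of_nat_numeral)
  then show ?thesis using Suc by simp
qed simp

text \<open>Bernoulli gives \<open>(1 - 1/r)^(r-1) \<ge> 1 - (r-1)/r = 1/r\<close>. This is the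
  whole price of replacing the graph by what is left after at most \<open>n/r\<close>
  deletions.\<close>

lemma bernoulli_power_ge:
  assumes r: "r \<ge> 2" and m: "(1 - 1 / real r) * real n \<le> real m"
  shows "real n ^ (r - 1) \<le> real r * real m ^ (r - 1)"
proof -
  have "1 + real (r - 1) * (- 1 / real r) \<le> (1 + - 1 / real r) ^ (r - 1)"
    using r by (intro Bernoulli_inequality) (simp add: field_simps)
  moreover have "1 + real (r - 1) * (- 1 / real r) = 1 / real r" using r by (simp add: field_simps)
  ultimately have "1 \<le> real r * (1 - 1 / real r) ^ (r - 1)" using r by (simp add: field_simps)
  then have "1 * real n ^ (r - 1) \<le> real r * (1 - 1 / real r) ^ (r - 1) * real n ^ (r - 1)"
    by (intro mult_right_mono) auto
  also have "\<dots> = real r * ((1 - 1 / real r) * real n) ^ (r - 1)" by (simp add: power_mult_distrib)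
  also have "\<dots> \<le> real r * real m ^ (r - 1)" using m r by (intro mult_left_mono power_mono) auto
  finally show ?thesis by simp
qed

text \<open>Both cases use this with \<open>b s\<close> a count of ordered cliques. The factors
  \<open>(r - s)/r\<close> for \<open>s = 2, ..., r - 1\<close> multiply to
  \<open>(r-2)!/r^(r-2)\<close>. At \<open>s = r\<close> this factor would vanish, so the last step
  lives on the surplus \<open>d\<close> alone.\<close>

lemma growth_chain:
  fixes b :: "nat \<Rightarrow> real"
  assumes r: "r \<ge> 2" and m: "m \<ge> 0"
    and step: "\<And>s. 2 \<le> s \<Longrightarrow> s < r \<Longrightarrow> real (r - s) * m * b s \<le> real r * b (Suc s)"
    and last: "d * m * b r \<le> b (Suc r)" and d: "d \<ge> 0"
  shows "d * m ^ (r - 1) * fact (r - 2) * b 2 \<le> real r ^ (r - 2) * b (Suc r)"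
proof -
  have chain: "m ^ j * fact (r - 2) * b 2 \<le> real r ^ j * fact (r - 2 - j) * b (2 + j)"
    if "j \<le> r - 2" for j
    using that
  proof (induction j)
    case (Suc j)
    have f: "fact (r - 2 - j) = real (r - (2 + j)) * fact (r - 2 - Suc j)"
      using Suc.prems fact_reduce[of "r - 2 - j", where 'a = real]
      by (simp add: diff_diff_add numeral_2_eq_2 algebra_simps)
    have "m ^ Suc j * fact (r - 2) * b 2 = m * (m ^ j * fact (r - 2) * b 2)" by simp
    also have "\<dots> \<le> m * (real r ^ j * fact (r - 2 - j) * b (2 + j))"
      using Suc m by (intro mult_left_mono) auto
    also have "\<dots> = real r ^ j * fact (r - 2 - Suc j) * (real (r - (2 + j)) * m * b (2 + j))"
      by (simp only: f mult_ac)
    also have "\<dots> \<le> real r ^ j * fact (r - 2 - Suc j) * (real r * b (Suc (2 + j)))"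
      using Suc.prems by (intro mult_left_mono step) auto
    finally show ?case by (simp add: algebra_simps)
  qed simp
  have r2: "2 + (r - 2) = r" "r - 1 = Suc (r - 2)" using r by auto
  have "d * m ^ (r - 1) * fact (r - 2) * b 2 = d * m * (m ^ (r - 2) * fact (r - 2) * b 2)"
    unfolding r2(2) by simp
  also have "\<dots> \<le> d * m * (real r ^ (r - 2) * b r)"
    using chain[of "r - 2"] d m r2(1) by (intro mult_left_mono) auto
  also have "\<dots> = real r ^ (r - 2) * (d * m * b r)" by simp
  also have "\<dots> \<le> real r ^ (r - 2) * b (Suc r)" by (intro mult_left_mono last) auto
  finally show ?thesis .
qed

section \<open>Cliques and common neighbourhoods\<close>

text \<open>With \<open>E\<close> fixed, an induced subgraph is just its vertex set
  \<open>W\<close>, so deleting a vertex or passing to a neighbourhood changes one set. As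
  \<open>{v, v} = {v}\<close>, excluding singletons keeps a clique disjoint from its common
  neighbourhood.\<close>

locale loopless =
  fixes E :: "'a set set"
  assumes no_loop: "{v} \<notin> E"
begin

definition cliques :: "'a set \<Rightarrow> nat \<Rightarrow> 'a set \<Rightarrow> 'a set set" where
  "cliques W k S = {K. K \<subseteq> W \<and> card K = k \<and> S \<subseteq> K \<and> is_clique E K}"

definition nbrs :: "'a set \<Rightarrow> 'a set \<Rightarrow> 'a set" where
  "nbrs W K = {v \<in> W. \<forall>u\<in>K. {u, v} \<in> E}"

lemma cliques_containing_eq: "cliques_containing W E k S = card (cliques W k S)"
  by (simp add: cliques_containing_def cliques_def)

lemma finite_cliques [simp]: "finite W \<Longrightarrow> finite (cliques W k S)"
  by (rule finite_subset[of _ "Pow W"]) (auto simp: cliques_def)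

lemma finite_nbrs [simp]: "finite W \<Longrightarrow> finite (nbrs W K)"
  by (auto simp: nbrs_def)

lemma nbrs_subset: "nbrs W K \<subseteq> W"
  by (auto simp: nbrs_def)

lemma nbrs_disjoint: "v \<in> nbrs W K \<Longrightarrow> v \<notin> K"
  using no_loop by (auto simp: nbrs_def)

lemma cliques_mono: "W \<subseteq> V \<Longrightarrow> cliques W k S \<subseteq> cliques V k S"
  by (auto simp: cliques_def)

lemma subset_clique: "K \<in> cliques W k S \<Longrightarrow> e \<subseteq> K \<Longrightarrow> card e = j \<Longrightarrow> e \<in> cliques W j {}"
  by (auto simp: cliques_def is_clique_def subset_iff)

lemma insert_nbr_clique:
  assumes "finite W" "K \<in> cliques W k S" "v \<in> nbrs W K"
  shows "insert v K \<in> cliques W (Suc k) S"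
proof -
  have "finite K" using assms by (auto simp: cliques_def intro: finite_subset)
  then show ?thesis
    using assms nbrs_disjoint[OF assms(3)]
    by (auto simp: cliques_def nbrs_def is_clique_def insert_commute)
qed

lemma remove_vertex_clique:
  assumes "finite W" "K \<in> cliques W (Suc k) S" "v \<in> K - S"
  shows "K - {v} \<in> cliques W k S" "v \<in> nbrs W (K - {v})"
proof -
  have "finite K" using assms by (auto simp: cliques_def intro: finite_subset)
  then show "K - {v} \<in> cliques W k S" "v \<in> nbrs W (K - {v})"
    using assms by (auto simp: cliques_def nbrs_def is_clique_def)
qed

text \<open>Pairs of a clique \<open>K\<close> and a removable vertex \<open>v\<close> correspond to
  pairs of the smaller clique \<open>L = K - {v}\<close> and a common neighbour of \<open>L\<close>.
  The weight \<open>g\<close> makes one bijection serve twice: \<open>g = 1\<close> counts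
  extensions, and \<open>g\<close> equal to the number of extensions yields their second
  moment.\<close>

lemma sum_clique_extensions:
  fixes g :: "'a set \<Rightarrow> real"
  assumes fin: "finite W"
  shows "(\<Sum>K\<in>cliques W (Suc k) S. \<Sum>v\<in>K - S. g (K - {v}))
       = (\<Sum>L\<in>cliques W k S. real (card (nbrs W L)) * g L)"
proof -
  have finK: "finite (K - S)" if "K \<in> cliques W (Suc k) S" for K
    using that fin by (auto simp: cliques_def intro: finite_subset)
  have "(\<Sum>K\<in>cliques W (Suc k) S. \<Sum>v\<in>K - S. g (K - {v}))
      = (\<Sum>(K, v)\<in>(SIGMA K:cliques W (Suc k) S. K - S). g (K - {v}))"
    using fin finK by (subst sum.Sigma) auto
  also have "\<dots> = (\<Sum>(L, v)\<in>(SIGMA L:cliques W k S. nbrs W L). g L)"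
  proof (rule sum.reindex_bij_witness[where i = "\<lambda>(L, v). (insert v L, v)"
        and j = "\<lambda>(K, v). (K - {v}, v)"], goal_cases)
    case (1 a) then show ?case by auto
  next
    case (2 a) then show ?case using remove_vertex_clique[OF fin] by auto
  next
    case (3 b) then show ?case using nbrs_disjoint by auto
  next
    case (4 b)
    then obtain L v where b: "b = (L, v)" "L \<in> cliques W k S" "v \<in> nbrs W L" by auto
    have "v \<notin> S" using b nbrs_disjoint[of v W L] by (auto simp: cliques_def)
    then show ?case using insert_nbr_clique[OF fin] b by auto
  qed (auto)
  also have "\<dots> = (\<Sum>L\<in>cliques W k S. \<Sum>v\<in>nbrs W L. g L)"
    using fin by (subst sum.Sigma) auto
  finally show ?thesis by simp
qed

lemma sum_card_nbrs:
  assumes fin: "finite W"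
  shows "(\<Sum>L\<in>cliques W k S. real (card (nbrs W L)))
       = (real (Suc k) - real (card S)) * real (card (cliques W (Suc k) S))"
proof -
  have "real (card (K - S)) = real (Suc k) - real (card S)" if "K \<in> cliques W (Suc k) S" for K
  proof -
    from that have "finite K" "S \<subseteq> K" "card K = Suc k"
      using fin by (auto simp: cliques_def intro: finite_subset)
    then show ?thesis
      by (metis card_Diff_subset card_mono finite_subset of_nat_diff)
  qed
  then show ?thesis using sum_clique_extensions[OF fin, where g = "\<lambda>_. 1" and k = k and S = S]
    by (simp add: mult.commute)
qed

lemma cliques_1: "cliques W (Suc 0) {} = (\<lambda>v. {v}) ` W"
  by (auto simp: cliques_def is_clique_def card_Suc_eq)

lemma card_cliques_1: "card (cliques W (Suc 0) {}) = card W"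
  unfolding cliques_1 by (rule card_image) auto

lemma sum_degrees:
  assumes "finite W"
  shows "(\<Sum>v\<in>W. real (card (nbrs W {v}))) = 2 * real (card (cliques W 2 {}))"
proof -
  have "(\<Sum>v\<in>W. real (card (nbrs W {v}))) = (\<Sum>L\<in>cliques W (Suc 0) {}. real (card (nbrs W L)))"
    unfolding cliques_1 by (subst sum.reindex) auto
  then show ?thesis using sum_card_nbrs[OF assms, of "Suc 0" "{}"] by (simp add: numeral_2_eq_2)
qed

lemma cliques_2_edge:
  assumes "e \<in> cliques W 2 {}" shows "e \<in> E" "e \<subseteq> W" "card e = 2"
proof -
  from assms obtain u v where "e = {u, v}" "u \<noteq> v"
    by (auto simp: cliques_def card_2_iff)
  with assms show "e \<in> E" "e \<subseteq> W" "card e = 2" by (auto simp: cliques_def is_clique_def)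
qed

section \<open>Moon--Moser inequalities\<close>

text \<open>Count by the vertex \<open>w\<close>: a common neighbour of \<open>K\<close> is counted
  \<open>card K\<close> times, whereas a \<open>w\<close> missing some \<open>x\<close> in
  \<open>K\<close> can be counted only for \<open>u = x\<close>.\<close>

lemma sum_nbrs_remove_vertex_le:
  assumes fin: "finite W" and K: "finite K" "K \<noteq> {}"
  shows "(\<Sum>u\<in>K. real (card (nbrs W (K - {u}))))
       \<le> real (card W) + (real (card K) - 1) * real (card (nbrs W K))"
proof -
  have "(\<Sum>u\<in>K. real (card (nbrs W (K - {u}))))
      = (\<Sum>w\<in>W. real (card {u \<in> K. \<forall>x\<in>K - {u}. {x, w} \<in> E}))"
    unfolding nbrs_def using sum_card_swap[OF K(1) fin] .
  also have "\<dots> \<le> (\<Sum>w\<in>W. 1 + (if w \<in> nbrs W K then real (card K) - 1 else 0))"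
  proof (rule sum_mono)
    fix w assume w: "w \<in> W"
    let ?X = "{u \<in> K. \<forall>x\<in>K - {u}. {x, w} \<in> E}"
    show "real (card ?X) \<le> 1 + (if w \<in> nbrs W K then real (card K) - 1 else 0)"
    proof (cases "w \<in> nbrs W K")
      case True
      have "card ?X \<le> card K" using K by (intro card_mono) auto
      then show ?thesis using True by simp
    next
      case False
      then obtain x where x: "x \<in> K" "{x, w} \<notin> E" using w by (auto simp: nbrs_def)
      have "?X \<subseteq> {x}" using x by auto
      then have "card ?X \<le> card {x}" by (intro card_mono) auto
      then show ?thesis using False by simp
    qed
  qed
  also have "\<dots> = real (card W) + (real (card K) - 1) * real (card (nbrs W K))"
    using fin nbrs_subset[of W K]
    by (simp add: sum.distrib sum.If_cases Int_absorb1 mult.commute)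
  finally show ?thesis .
qed

text \<open>This is Cauchy-Schwarz linearised at \<open>c\<close>: summing
  \<open>d(L)^2 \<ge> 2 c d(L) - c^2\<close> over the \<open>k\<close>-cliques avoids dividing by
  their number. The second moment is bounded above by counting over \<open>(k+1)\<close>-cliques,
  and \<open>prev\<close>, which says that \<open>c\<close> is at most the average of
  \<open>d(L)\<close>, removes the term with \<open>c^2\<close>.\<close>

lemma moon_moser_step:
  assumes fin: "finite W" and c: "c \<ge> 0"
    and prev: "c * real (card (cliques W k {})) \<le> real (Suc k) * real (card (cliques W (Suc k) {}))"
  shows "(real (Suc k) * c - real (card W)) * real (card (cliques W (Suc k) {}))
       \<le> real k * real (k + 2) * real (card (cliques W (Suc (Suc k)) {}))"
proof -
  let ?N = "\<lambda>s. real (card (cliques W s {}))"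
  let ?d = "\<lambda>L. real (card (nbrs W L))"
  have "2 * c * (real (Suc k) * ?N (Suc k)) - c\<^sup>2 * ?N k
      = (\<Sum>L\<in>cliques W k {}. 2 * c * ?d L - c\<^sup>2)"
    using sum_card_nbrs[OF fin, of k "{}"] by (simp add: sum_subtractf flip: sum_distrib_left)
  also have "\<dots> \<le> (\<Sum>L\<in>cliques W k {}. ?d L * ?d L)"
  proof (rule sum_mono)
    fix L
    have "0 \<le> (?d L - c)\<^sup>2" by simp
    then show "2 * c * ?d L - c\<^sup>2 \<le> ?d L * ?d L"
      by (simp add: power2_eq_square algebra_simps)
  qed
  also have "\<dots> = (\<Sum>K\<in>cliques W (Suc k) {}. \<Sum>v\<in>K - {}. ?d (K - {v}))"
    using sum_clique_extensions[OF fin, where g = ?d and S = "{}"] by simp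
  also have "\<dots> \<le> (\<Sum>K\<in>cliques W (Suc k) {}. real (card W) + real k * ?d K)"
  proof (rule sum_mono)
    fix K assume "K \<in> cliques W (Suc k) {}"
    then have "finite K" "card K = Suc k" "K \<noteq> {}"
      using fin by (auto simp: cliques_def intro: finite_subset)
    then show "(\<Sum>v\<in>K - {}. ?d (K - {v})) \<le> real (card W) + real k * ?d K"
      using sum_nbrs_remove_vertex_le[OF fin, of K] by simp
  qed
  also have "\<dots> = real (card W) * ?N (Suc k) + real k * (real (k + 2) * ?N (Suc (Suc k)))"
    using sum_card_nbrs[OF fin, of "Suc k" "{}"]
    by (simp add: sum.distrib algebra_simps flip: sum_distrib_left)
  finally have "2 * c * (real (Suc k) * ?N (Suc k)) - c\<^sup>2 * ?N k
      \<le> real (card W) * ?N (Suc k) + real k * (real (k + 2) * ?N (Suc (Suc k)))" .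
  moreover have "c\<^sup>2 * ?N k \<le> c * (real (Suc k) * ?N (Suc k))"
    using mult_left_mono[OF prev c] by (simp add: power2_eq_square mult.assoc)
  ultimately show ?thesis by (simp add: algebra_simps)
qed

text \<open>With edge density \<open>1 - t\<close>, an average \<open>k\<close>-clique has at least
  \<open>(1 - k t) m\<close> extensions. The condition \<open>r t \<le> 1\<close> keeps this bound
  nonnegative, as the induction step requires of its \<open>c\<close>.\<close>

lemma moon_moser:
  assumes fin: "finite W" and t: "real r * t \<le> 1" "0 \<le> t"
    and edges: "(1 - t) * real (card W)^2 \<le> 2 * real (card (cliques W 2 {}))"
    and s: "s < r"
  shows "real (card W) * (1 - real (Suc s) * t) * real (card (cliques W (Suc s) {}))
       \<le> real (s + 2) * real (card (cliques W (Suc (Suc s)) {}))"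
  using s
proof (induction s)
  case 0
  show ?case using edges
    by (simp add: card_cliques_1 power2_eq_square numeral_2_eq_2 algebra_simps)
next
  case (Suc s)
  let ?m = "real (card W)"
  have "real (Suc s) * t \<le> real r * t" using Suc.prems t by (intro mult_right_mono) auto
  then have c: "0 \<le> ?m * (1 - real (Suc s) * t)" using t by auto
  have prev: "?m * (1 - real (Suc s) * t) * real (card (cliques W (Suc s) {}))
       \<le> real (Suc (Suc s)) * real (card (cliques W (Suc (Suc s)) {}))"
    using Suc by simp
  \<comment> \<open>With \<open>k = s + 1\<close> and \<open>c = m (1 - k t)\<close>, the
    coefficient \<open>(k+1) c - m\<close> equals \<open>k m (1 - (k+1) t)\<close>; the factor
    \<open>k\<close> then cancels.\<close>
  have "real (Suc s) * (?m * (1 - real (Suc (Suc s)) * t) * real (card (cliques W (Suc (Suc s)) {})))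
      = (real (Suc (Suc s)) * (?m * (1 - real (Suc s) * t)) - ?m) * real (card (cliques W (Suc (Suc s)) {}))"
    by (simp add: algebra_simps)
  also have "\<dots> \<le> real (Suc s) * (real (Suc s + 2) * real (card (cliques W (Suc (Suc (Suc s))) {})))"
    using moon_moser_step[OF fin c prev] by (simp add: mult.assoc)
  finally show ?case using mult_le_cancel_left_pos[of "real (Suc s)"] by simp
qed

text \<open>Averaging over the edges: each \<open>(r+1)\<close>-clique contains \<open>(r+1) choose 2\<close> of them.\<close>

lemma dense_edge_in_many_cliques:
  assumes fin: "finite W" and ne: "W \<noteq> {}" and r: "r \<ge> 2" and \<eta>: "0 < \<eta>" "\<eta> \<le> 1 / real r"
    and edges: "(1 - 1 / real r + \<eta>) * real (card W)^2 \<le> 2 * real (card (cliques W 2 {}))"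
  shows "\<exists>e\<in>cliques W 2 {}. real r * \<eta> * real (card W) ^ (r - 1)
     \<le> real (r - 1) * real r ^ (r - 2) * real (card (cliques W (r + 1) e))"
proof (rule ccontr)
  assume "\<not> ?thesis"
  then have small: "real (r - 1) * real r ^ (r - 2) * real (card (cliques W (r + 1) e))
      < real r * \<eta> * real (card W) ^ (r - 1)" if "e \<in> cliques W 2 {}" for e
    using that by fastforce
  let ?m = "real (card W)"
  let ?k = "\<lambda>s. real (card (cliques W s {}))"
  define t where "t = 1 / real r - \<eta>"
  have t: "real r * t \<le> 1" "0 \<le> t" using r \<eta> by (auto simp: t_def algebra_simps)
  have m: "?m > 0" using fin ne by (simp add: card_gt_0_iff)
  have "0 < (1 - 1 / real r + \<eta>) * ?m^2" using m r \<eta> by (intro mult_pos_pos) (auto simp: add_nonneg_pos)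
  then have k2: "?k 2 > 0" using edges by linarith
  then have k2ne: "cliques W 2 {} \<noteq> {}" by force
  have mm: "?m * (1 - real s * t) * ?k s \<le> real (s + 1) * ?k (Suc s)" if "1 \<le> s" "s \<le> r" for s
  proof -
    have "(1 - t) * ?m^2 \<le> 2 * ?k 2" using edges by (simp add: t_def algebra_simps)
    from moon_moser[OF fin t this, of "s - 1"] that show ?thesis by simp
  qed
  \<comment> \<open>The weight \<open>fact s\<close> turns cliques into ordered cliques and absorbs
    the factor \<open>s + 1\<close> of Moon--Moser. Since
    \<open>1 - s t = (r - s)/r + s \<eta>\<close>, the part with \<eta> is dropped for
    \<open>s < r\<close> and is all that remains, namely \<open>r \<eta>\<close>, for
    \<open>s = r\<close>.\<close>
  have chain: "real r * \<eta> * ?m ^ (r - 1) * fact (r - 2) * (fact 2 * ?k 2) \<le> real r ^ (r - 2) * (fact (Suc r) * ?k (Suc r))"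
  proof (rule growth_chain[OF r, where b = "\<lambda>s. fact s * ?k s"])
    fix s :: nat assume s: "2 \<le> s" "s < r"
    have "real (r - s) \<le> real r * (1 - real s * t)"
    proof -
      have "real r * (1 - real s * t) = real r - real s + real r * real s * \<eta>"
        using r by (simp add: t_def field_simps)
      then show ?thesis using s \<eta> by simp
    qed
    then have "real (r - s) * ?m * ?k s \<le> real r * (1 - real s * t) * ?m * ?k s"
      by (intro mult_right_mono) auto
    also have "\<dots> = real r * (?m * (1 - real s * t) * ?k s)" by simp
    also have "\<dots> \<le> real r * (real (s + 1) * ?k (Suc s))"
      using mm[of s] s by (intro mult_left_mono) auto
    finally have "fact s * (real (r - s) * ?m * ?k s) \<le> fact s * (real r * (real (s + 1) * ?k (Suc s)))"
      by (intro mult_left_mono) auto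
    then show "real (r - s) * ?m * (fact s * ?k s) \<le> real r * (fact (Suc s) * ?k (Suc s))"
      by (simp add: algebra_simps)
  next
    have "1 - real r * t = real r * \<eta>" using r by (simp add: t_def field_simps)
    then have "real r * \<eta> * ?m * ?k r \<le> real (r + 1) * ?k (Suc r)"
      using mm[of r] r by (simp add: mult_ac)
    then have "fact r * (real r * \<eta> * ?m * ?k r) \<le> fact r * (real (r + 1) * ?k (Suc r))"
      by (intro mult_left_mono) auto
    then show "real r * \<eta> * ?m * (fact r * ?k r) \<le> fact (Suc r) * ?k (Suc r)"
      by (simp add: algebra_simps)
  qed (use \<eta> in auto)
  have "(\<Sum>e\<in>cliques W 2 {}. real (card (cliques W (r + 1) e)))
      = (\<Sum>e\<in>cliques W 2 {}. real (card {K \<in> cliques W (r + 1) {}. e \<subseteq> K}))"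
  proof (rule sum.cong)
    fix e
    have "cliques W (r + 1) e = {K \<in> cliques W (r + 1) {}. e \<subseteq> K}" by (auto simp: cliques_def)
    then show "real (card (cliques W (r + 1) e)) = real (card {K \<in> cliques W (r + 1) {}. e \<subseteq> K})" by simp
  qed simp
  also have "\<dots> = (\<Sum>K\<in>cliques W (r + 1) {}. real (card {e \<in> cliques W 2 {}. e \<subseteq> K}))"
    using fin by (intro sum_card_swap) auto
  also have "\<dots> = (\<Sum>K\<in>cliques W (r + 1) {}. real ((r + 1) choose 2))"
  proof (rule sum.cong)
    fix K assume K: "K \<in> cliques W (r + 1) {}"
    then have "finite K" "card K = r + 1" using fin by (auto simp: cliques_def intro: finite_subset)
    moreover have "{e \<in> cliques W 2 {}. e \<subseteq> K} = {e. e \<subseteq> K \<and> card e = 2}"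
      using subset_clique[OF K] cliques_2_edge(3) by auto
    ultimately show "real (card {e \<in> cliques W 2 {}. e \<subseteq> K}) = real ((r + 1) choose 2)"
      using n_subsets[of K 2] by simp
  qed simp
  finally have avg: "(\<Sum>e\<in>cliques W 2 {}. real (card (cliques W (r + 1) e))) = real ((r + 1) choose 2) * ?k (r + 1)"
    by (simp add: mult.commute)
  have ch: "real ((r + 1) choose 2) = real (r + 1) * real r / 2"
    by (simp add: real_choose_two)
  have f1: "fact (Suc r) = real (r + 1) * real r * (real (r - 1) * fact (r - 2))"
  proof -
    obtain q where "r = Suc (Suc q)" using r by (metis add_2_eq_Suc le_Suc_ex)
    then show ?thesis by (simp add: algebra_simps)
  qed
  have "real (r - 1) * real r ^ (r - 2) * (\<Sum>e\<in>cliques W 2 {}. real (card (cliques W (r + 1) e)))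
      < (\<Sum>e\<in>cliques W 2 {}. real r * \<eta> * ?m ^ (r - 1))"
    unfolding sum_distrib_left using fin k2ne small by (intro sum_strict_mono) auto
  also have "\<dots> = real r * \<eta> * ?m ^ (r - 1) * ?k 2" by simp
  finally have "fact (r - 2) * 2 * (real (r - 1) * real r ^ (r - 2) * (real (r + 1) * real r / 2 * ?k (r + 1)))
      < fact (r - 2) * 2 * (real r * \<eta> * ?m ^ (r - 1) * ?k 2)"
    unfolding avg ch by (intro mult_strict_left_mono) auto
  also have "\<dots> = real r * \<eta> * ?m ^ (r - 1) * fact (r - 2) * (fact 2 * ?k 2)" by (simp add: fact_2)
  also note chain
  also have "real r ^ (r - 2) * (fact (Suc r) * ?k (Suc r))
      = fact (r - 2) * 2 * (real (r - 1) * real r ^ (r - 2) * (real (r + 1) * real r / 2 * ?k (r + 1)))"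
    unfolding f1 by simp
  finally show False by simp
qed

text \<open>Any positive excess, normalised by \<open>m^2\<close> and capped at \<open>1/r\<close>,
  is an admissible \<eta> for the averaging bound, whose left side is then positive.\<close>

lemma exists_clique_if_many_edges:
  assumes fin: "finite W" and r: "r \<ge> 2"
    and edges: "(1 - 1 / real r) * real (card W)^2 < 2 * real (card (cliques W 2 {}))"
  shows "cliques W (r + 1) {} \<noteq> {}"
proof -
  let ?m = "real (card W)"
  have ne: "W \<noteq> {}"
  proof
    assume "W = {}"
    then have "cliques W 2 {} = {}" by (auto simp: cliques_def)
    then show False using edges \<open>W = {}\<close> by simp
  qed
  then have m: "?m > 0" using fin by (simp add: card_gt_0_iff)
  define \<eta> where "\<eta> = min (1 / real r) ((2 * real (card (cliques W 2 {})) - (1 - 1 / real r) * ?m^2) / ?m^2)"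
  have pos: "0 < \<eta>" "\<eta> \<le> 1 / real r" using edges m r by (auto simp: \<eta>_def)
  have "\<eta> * ?m^2 \<le> (2 * real (card (cliques W 2 {})) - (1 - 1 / real r) * ?m^2) / ?m^2 * ?m^2"
    by (intro mult_right_mono) (auto simp: \<eta>_def)
  also have "\<dots> = 2 * real (card (cliques W 2 {})) - (1 - 1 / real r) * ?m^2" using m by simp
  finally have "(1 - 1 / real r + \<eta>) * ?m^2 \<le> 2 * real (card (cliques W 2 {}))"
    by (simp add: distrib_right)
  from dense_edge_in_many_cliques[OF fin ne r pos this] obtain e where
    e: "real r * \<eta> * ?m ^ (r - 1) \<le> real (r - 1) * real r ^ (r - 2) * real (card (cliques W (r + 1) e))"
    by auto
  have "0 < real r * \<eta> * ?m ^ (r - 1)" using r pos m by auto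
  with e have "cliques W (r + 1) e \<noteq> {}" by force
  then show ?thesis by (auto simp: cliques_def)
qed

section \<open>Large minimum degree\<close>

text \<open>Let \<open>d w\<close> be the number of neighbours of \<open>w\<close> in
  \<open>K\<close>. The sum of \<open>d w choose 2\<close> over \<open>W\<close> equals the sum of
  the codegrees of the pairs in \<open>K\<close>, while the degrees bound the sum of
  \<open>d w\<close> from below. Convexity links the two sums, and dividing by
  \<open>(r+1) choose 2\<close> gives the coefficient.\<close>

lemma high_codegree_edge_in_clique:
  assumes fin: "finite W" and r: "r \<ge> 2" and K: "K \<in> cliques W (r + 1) {}"
    and deg: "\<And>v. v \<in> W \<Longrightarrow> \<alpha> * real (card W) \<le> real (card (nbrs W {v}))"
  shows "\<exists>e\<in>cliques W 2 {}. (2 * real (r - 1) / real r * \<alpha> - real (r - 1) / real (r + 1)) * real (card W)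
     \<le> real (card (nbrs W e))"
proof (rule ccontr)
  assume contra: "\<not> ?thesis"
  define \<beta> where "\<beta> = 2 * real (r - 1) / real r * \<alpha> - real (r - 1) / real (r + 1)"
  let ?m = "real (card W)"
  have small: "real (card (nbrs W e)) < \<beta> * ?m" if "e \<in> cliques W 2 {}" for e
    using that contra unfolding \<beta>_def by fastforce
  have K': "finite K" "card K = r + 1" "K \<subseteq> W" using K fin by (auto simp: cliques_def intro: finite_subset)
  define P where "P = {e. e \<subseteq> K \<and> card e = 2}"
  have P: "finite P" "card P = (r + 1) choose 2"
    using K' n_subsets[of K 2] by (auto simp: P_def)
  have PW: "P \<subseteq> cliques W 2 {}" using subset_clique[OF K] by (auto simp: P_def)
  have ch: "real ((r + 1) choose 2) = real (r + 1) * real r / 2"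
    by (simp add: real_choose_two)
  have "P \<noteq> {}" using P(2) r by force
  define d where "d w = card {v \<in> K. {v, w} \<in> E}" for w
  have sumd: "(\<Sum>v\<in>K. real (card (nbrs W {v}))) = (\<Sum>w\<in>W. real (d w))"
    unfolding d_def nbrs_def using sum_card_swap[OF K'(1) fin, of "\<lambda>v w. {v, w} \<in> E"] by simp
  have "real (r + 1) * (\<alpha> * ?m) = (\<Sum>v\<in>K. \<alpha> * ?m)" using K' by simp
  also have "\<dots> \<le> (\<Sum>w\<in>W. real (d w))" unfolding sumd[symmetric]
    using K' deg by (intro sum_mono) auto
  finally have d_ge: "real (r + 1) * (\<alpha> * ?m) \<le> (\<Sum>w\<in>W. real (d w))" .
  have "real (r - 1) * (real (r + 1) * (\<alpha> * ?m)) - real r * real (r - 1) / 2 * ?m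
      \<le> real (r - 1) * (\<Sum>w\<in>W. real (d w)) - real r * real (r - 1) / 2 * ?m"
    using d_ge by (intro diff_right_mono mult_left_mono) auto
  also have "\<dots> = (\<Sum>w\<in>W. real (r - 1) * real (d w) - real r * real (r - 1) / 2)"
    by (simp add: sum_subtractf sum_distrib_left)
  also have "\<dots> \<le> (\<Sum>w\<in>W. real (d w choose 2))"
  proof (rule sum_mono)
    fix w
    \<comment> \<open>A product of two consecutive integers is nonnegative, so
      \<open>d choose 2\<close> lies above its chord through \<open>d = r - 1\<close> and
      \<open>d = r\<close>. For \<alpha> near \<open>1 - 1/r\<close> the lower bound on the average
      of \<open>d w\<close> is near \<open>r - 1/r\<close>, between these points.\<close>
    have "0 \<le> (int (d w) - int r) * (int (d w) - int r + 1)"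
      by (cases "int (d w) \<ge> int r") (auto intro: mult_nonneg_nonneg mult_nonpos_nonpos)
    then have "0 \<le> real_of_int ((int (d w) - int r) * (int (d w) - int r + 1))" by linarith
    then have "0 \<le> (real (d w) - real r) * (real (d w) - real r + 1)" by simp
    moreover have "real (d w choose 2) = real (d w) * (real (d w) - 1) / 2"
      by (rule real_choose_two)
    ultimately show "real (r - 1) * real (d w) - real r * real (r - 1) / 2 \<le> real (d w choose 2)"
      using r by (simp add: of_nat_diff field_simps)
  qed
  also have "\<dots> = (\<Sum>w\<in>W. real (card {e \<in> P. \<forall>u\<in>e. {u, w} \<in> E}))"
  proof (rule sum.cong)
    fix w
    have "{e \<in> P. \<forall>u\<in>e. {u, w} \<in> E} = {e. e \<subseteq> {v \<in> K. {v, w} \<in> E} \<and> card e = 2}"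
      unfolding P_def by auto
    then show "real (d w choose 2) = real (card {e \<in> P. \<forall>u\<in>e. {u, w} \<in> E})"
      using n_subsets[of "{v \<in> K. {v, w} \<in> E}" 2] K' by (simp add: d_def)
  qed simp
  also have "\<dots> = (\<Sum>e\<in>P. real (card (nbrs W e)))"
    unfolding nbrs_def using sum_card_swap[OF P(1) fin, of "\<lambda>e w. \<forall>u\<in>e. {u, w} \<in> E"] by simp
  also have "\<dots> < (\<Sum>e\<in>P. \<beta> * ?m)"
    using P PW \<open>P \<noteq> {}\<close> small by (intro sum_strict_mono) auto
  also have "\<dots> = real (r + 1) * real r / 2 * (\<beta> * ?m)" using P ch by simp
  also have "\<dots> = real (r - 1) * (real (r + 1) * (\<alpha> * ?m)) - real r * real (r - 1) / 2 * ?m"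
  proof -
    have eq: "c * b / 2 * ((2 * a / b * \<alpha> - a / c) * y) = a * (c * (\<alpha> * y)) - b * a / 2 * y"
      if "b \<noteq> 0" "c \<noteq> 0" for a b c y :: real
      using that by (simp add: field_simps)
    show ?thesis unfolding \<beta>_def using r by (intro eq) auto
  qed
  finally show False by simp
qed

text \<open>Union bound: each vertex of \<open>L - e\<close> has at most \<kappa>\<open>m\<close>
  non-neighbours in \<open>W\<close>, and only these can leave the common neighbourhood of
  \<open>e\<close>.\<close>

lemma card_nbrs_ge:
  assumes fin: "finite W" and "e \<subseteq> L" "L \<subseteq> W"
    and deg: "\<And>v. v \<in> W \<Longrightarrow> (1 - \<kappa>) * real (card W) \<le> real (card (nbrs W {v}))"
  shows "real (card (nbrs W e)) - real (card (L - e)) * \<kappa> * real (card W) \<le> real (card (nbrs W L))"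
proof -
  have finL: "finite (L - e)" using assms by (auto intro: finite_subset)
  have "nbrs W e \<subseteq> nbrs W L \<union> (\<Union>v\<in>L - e. W - nbrs W {v})"
    by (auto simp: nbrs_def)
  then have "card (nbrs W e) \<le> card (nbrs W L \<union> (\<Union>v\<in>L - e. W - nbrs W {v}))"
    using fin finL by (intro card_mono) auto
  also have "\<dots> \<le> card (nbrs W L) + card (\<Union>v\<in>L - e. W - nbrs W {v})" by (rule card_Un_le)
  also have "\<dots> \<le> card (nbrs W L) + (\<Sum>v\<in>L - e. card (W - nbrs W {v}))"
    by (intro add_left_mono card_UN_le finL)
  finally have "real (card (nbrs W e)) \<le> real (card (nbrs W L) + (\<Sum>v\<in>L - e. card (W - nbrs W {v})))"
    by (rule of_nat_mono)
  then have "real (card (nbrs W e)) \<le> real (card (nbrs W L)) + (\<Sum>v\<in>L - e. real (card (W - nbrs W {v})))"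
    by simp
  also have "(\<Sum>v\<in>L - e. real (card (W - nbrs W {v}))) \<le> (\<Sum>v\<in>L - e. \<kappa> * real (card W))"
  proof (rule sum_mono)
    fix v assume "v \<in> L - e"
    then have "(1 - \<kappa>) * real (card W) \<le> real (card (nbrs W {v}))" using deg assms by auto
    moreover have "real (card (W - nbrs W {v})) = real (card W) - real (card (nbrs W {v}))"
      using fin nbrs_subset[of W "{v}"] by (simp add: card_Diff_subset card_mono of_nat_diff)
    ultimately show "real (card (W - nbrs W {v})) \<le> \<kappa> * real (card W)" by (simp add: algebra_simps)
  qed
  finally show ?thesis by simp
qed

lemma min_degree_edge_in_many_cliques:
  assumes fin: "finite W" and r: "r \<ge> 2" and K: "cliques W (r + 1) {} \<noteq> {}"
    and deg: "\<And>v. v \<in> W \<Longrightarrow> (1 - 1 / real r - 1 / real r ^ 4) * real (card W) \<le> real (card (nbrs W {v}))"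
  shows "\<exists>e\<in>cliques W 2 {}. real (card W) ^ (r - 1)
     \<le> real r ^ (r + 1) * real (r + 1) * real (card (cliques W (r + 1) e))"
proof -
  let ?m = "real (card W)"
  define x where "x = real r"
  have x: "x \<ge> 2" "real r = x" "real (r - 1) = x - 1" "real (r + 1) = x + 1" using r by (auto simp: x_def)
  define \<epsilon> where "\<epsilon> = 1 / x ^ 4"
  define \<beta> where "\<beta> = 2 * (x - 1) / x * (1 - 1 / x - \<epsilon>) - (x - 1) / (x + 1)"
  \<comment> \<open>This is \<open>2/(x^2 (x+1)) - x * \<epsilon>\<close>, the surplus of the best
    edge minus an upper bound for all losses due to \<epsilon>. It bounds from below the fraction of
    \<open>W\<close> still available for the last extension, from \<open>r\<close> to
    \<open>r + 1\<close> vertices.\<close>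
  define d where "d = (x - 1) / (x ^ 3 * (x + 1))"
  have \<beta>: "\<beta> - (x - 2) * (1 / x + \<epsilon>) \<ge> d"
  proof -
    have nz: "x \<noteq> 0" "x + 1 \<noteq> 0" "1 + x \<noteq> 0" using x by auto
    have "\<beta> - (x - 2) * (1 / x + \<epsilon>) = 2 / (x ^ 2 * (x + 1)) - (x - 2 / x) * \<epsilon>"
      using nz by (simp add: \<beta>_def divide_simps) (simp add: algebra_simps power2_eq_square)
    moreover have "(x - 2 / x) * \<epsilon> \<le> x * \<epsilon>" using x by (intro mult_right_mono) (auto simp: \<epsilon>_def)
    moreover have "2 / (x ^ 2 * (x + 1)) - x * \<epsilon> = d"
      using x by (simp add: \<epsilon>_def d_def divide_simps) (simp add: algebra_simps power_numeral_reduce)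
    ultimately show ?thesis by linarith
  qed
  have d: "d \<ge> 0" using x by (simp add: d_def)
  obtain K where "K \<in> cliques W (r + 1) {}" using K by auto
  from high_codegree_edge_in_clique[OF fin r this deg] obtain e
    where e: "e \<in> cliques W 2 {}" "\<beta> * ?m \<le> real (card (nbrs W e))"
    unfolding \<beta>_def \<epsilon>_def x(2-4) by blast
  note e' = cliques_2_edge[OF e(1)]
  let ?N = "\<lambda>s. real (card (cliques W s e))"
  \<comment> \<open>An \<open>s\<close>-clique on \<open>e\<close> has \<open>s - 2\<close> further
    vertices, each excluding at most \<open>(1/x + \<epsilon>) m\<close> common neighbours of
    \<open>e\<close>. An \<open>(s+1)\<close>-clique on \<open>e\<close> arises \<open>s - 1\<close>
    times, once for each vertex outside \<open>e\<close>.\<close>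
  have ext: "(\<beta> - (real s - 2) * (1 / x + \<epsilon>)) * ?m * ?N s \<le> (real s - 1) * ?N (Suc s)"
    if s: "2 \<le> s" for s
  proof -
    have "(\<beta> - (real s - 2) * (1 / x + \<epsilon>)) * ?m * ?N s
        = (\<Sum>L\<in>cliques W s e. (\<beta> - (real s - 2) * (1 / x + \<epsilon>)) * ?m)" by simp
    also have "\<dots> \<le> (\<Sum>L\<in>cliques W s e. real (card (nbrs W L)))"
    proof (rule sum_mono)
      fix L assume "L \<in> cliques W s e"
      then have L: "e \<subseteq> L" "L \<subseteq> W" "card L = s" by (auto simp: cliques_def)
      have "real (card (nbrs W e)) - real (card (L - e)) * (1 / x + \<epsilon>) * ?m \<le> real (card (nbrs W L))"
        using deg by (intro card_nbrs_ge[OF fin L(1,2)]) (auto simp: \<epsilon>_def x(2) algebra_simps)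
      moreover have "real (card (L - e)) = real s - 2"
        using L e' s fin by (simp add: card_Diff_subset finite_subset of_nat_diff)
      ultimately show "(\<beta> - (real s - 2) * (1 / x + \<epsilon>)) * ?m \<le> real (card (nbrs W L))"
        using e(2) by (simp add: algebra_simps)
    qed
    also have "\<dots> = (real s - 1) * ?N (Suc s)"
      using sum_card_nbrs[OF fin, of s e] e' by simp
    finally show ?thesis .
  qed
  have N2: "?N 2 = 1"
  proof -
    have "cliques W 2 e = {e}"
    proof (intro equalityI subsetI)
      fix K assume "K \<in> cliques W 2 e"
      then have "finite K" "e \<subseteq> K" "card K = 2" using fin by (auto simp: cliques_def intro: finite_subset)
      then have "e = K" using e'(3) by (intro card_subset_eq) auto
      then show "K \<in> {e}" by simp
    next
      fix K assume "K \<in> {e}" then show "K \<in> cliques W 2 e" using e(1) by (auto simp: cliques_def)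
    qed
    then show ?thesis by simp
  qed
  \<comment> \<open>\<open>fact (s - 2) * ?N s\<close> counts the ordered extensions of
    \<open>e\<close> to an \<open>s\<close>-clique, starting from 1 at \<open>s = 2\<close>.\<close>
  have "d * ?m ^ (r - 1) * fact (r - 2) * (fact (2 - 2) * ?N 2) \<le> real r ^ (r - 2) * (fact (Suc r - 2) * ?N (Suc r))"
  proof (rule growth_chain[OF r, where b = "\<lambda>s. fact (s - 2) * ?N s"])
    fix s :: nat assume s: "2 \<le> s" "s < r"
    have fs: "fact (Suc s - 2) = (real s - 1) * (fact (s - 2) :: real)"
    proof -
      obtain q where "s = Suc (Suc q)" using s by (metis add_2_eq_Suc le_Suc_ex)
      then show ?thesis by (simp add: algebra_simps)
    qed
    have "real (r - s) / x \<le> \<beta> - (real s - 2) * (1 / x + \<epsilon>)"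
    proof -
      have "\<beta> - (real s - 2) * (1 / x + \<epsilon>)
          = (\<beta> - (x - 2) * (1 / x + \<epsilon>)) + (x - real s) * (1 / x + \<epsilon>)"
        by (simp add: algebra_simps)
      moreover have "(x - real s) * (1 / x) \<le> (x - real s) * (1 / x + \<epsilon>)"
        using s by (intro mult_left_mono) (auto simp: \<epsilon>_def x_def)
      ultimately show ?thesis using \<beta> d s by (simp add: x_def of_nat_diff)
    qed
    then have "real (r - s) / x * (?m * ?N s) \<le> (\<beta> - (real s - 2) * (1 / x + \<epsilon>)) * (?m * ?N s)"
      by (intro mult_right_mono) auto
    also have "\<dots> \<le> (real s - 1) * ?N (Suc s)" using ext[of s] s by (simp add: mult.assoc)
    finally have "x * fact (s - 2) * (real (r - s) / x * (?m * ?N s)) \<le> x * fact (s - 2) * ((real s - 1) * ?N (Suc s))"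
      using x by (intro mult_left_mono) auto
    then show "real (r - s) * ?m * (fact (s - 2) * ?N s) \<le> real r * (fact (Suc s - 2) * ?N (Suc s))"
      unfolding fs using x by (simp add: mult_ac)
  next
    have fs: "fact (Suc r - 2) = (x - 1) * (fact (r - 2) :: real)"
    proof -
      obtain q where "r = Suc (Suc q)" using r by (metis add_2_eq_Suc le_Suc_ex)
      then show ?thesis by (simp add: x_def algebra_simps)
    qed
    have "d * (?m * ?N r) \<le> (\<beta> - (x - 2) * (1 / x + \<epsilon>)) * (?m * ?N r)"
      using \<beta> by (intro mult_right_mono) auto
    also have "\<dots> \<le> (x - 1) * ?N (Suc r)" using ext[of r] r by (simp add: x_def mult.assoc)
    finally have "fact (r - 2) * (d * (?m * ?N r)) \<le> fact (r - 2) * ((x - 1) * ?N (Suc r))"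
      by (intro mult_left_mono) auto
    then show "d * ?m * (fact (r - 2) * ?N r) \<le> fact (Suc r - 2) * ?N (Suc r)"
      unfolding fs by (simp add: mult_ac)
  qed (use d in auto)
  moreover have "fact (Suc r - 2) = (x - 1) * (fact (r - 2) :: real)"
  proof -
    obtain q where "r = Suc (Suc q)" using r by (metis add_2_eq_Suc le_Suc_ex)
    then show ?thesis by (simp add: x_def algebra_simps)
  qed
  ultimately have "fact (r - 2) * (d * ?m ^ (r - 1)) \<le> fact (r - 2) * (x ^ (r - 2) * (x - 1) * ?N (r + 1))"
    using N2 by (simp add: x(2) mult_ac)
  then have "d * ?m ^ (r - 1) \<le> x ^ (r - 2) * (x - 1) * ?N (r + 1)" by simp
  then have "(x ^ 3 * (x + 1) / (x - 1)) * (d * ?m ^ (r - 1))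
      \<le> (x ^ 3 * (x + 1) / (x - 1)) * (x ^ (r - 2) * (x - 1) * ?N (r + 1))"
    using x by (intro mult_left_mono) auto
  moreover have "(x ^ 3 * (x + 1) / (x - 1)) * d = 1" using x by (simp add: d_def)
  moreover have "(x ^ 3 * (x + 1) / (x - 1)) * (x ^ (r - 2) * (x - 1)) = x ^ (r + 1) * (x + 1)"
  proof -
    have "x ^ (r + 1) = x ^ 3 * x ^ (r - 2)" using r by (simp flip: power_add)
    then show ?thesis using x by simp
  qed
  ultimately have "?m ^ (r - 1) \<le> x ^ (r + 1) * (x + 1) * ?N (r + 1)"
    by (simp only: mult.assoc[symmetric])
  then show ?thesis unfolding x(2,4) using e(1) by blast
qed

section \<open>Uniqueness in Turan's theorem\<close>

text \<open>Erdos's degree majorisation: split off the non-neighbours of a vertex of maximum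
  degree as one colour class and recurse into its neighbourhood.\<close>

lemma degree_majorisation:
  assumes "finite W" "cliques W (Suc r) {} = {}"
  shows "\<exists>c :: 'a \<Rightarrow> nat. (\<forall>v\<in>W. c v < r) \<and>
     (\<forall>v\<in>W. card (nbrs W {v}) \<le> card {w \<in> W. c w \<noteq> c v}) \<and>
     ((\<forall>v\<in>W. card (nbrs W {v}) = card {w \<in> W. c w \<noteq> c v}) \<longrightarrow>
       (\<forall>u\<in>W. \<forall>v\<in>W. {u, v} \<in> E \<longleftrightarrow> c u \<noteq> c v))"
  using assms
proof (induction r arbitrary: W)
  case 0
  then have "W = {}" unfolding cliques_1 by simp
  then show ?case by simp
next
  case (Suc r)
  note fin = Suc.prems(1)
  show ?case
  proof (cases "W = {}")
    case False
    let ?D = "(\<lambda>v. card (nbrs W {v})) ` W"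
    have "Max ?D \<in> ?D" using fin False by (intro Max_in) auto
    then obtain x where "x \<in> W" and Dx: "Max ?D = card (nbrs W {x})" by (rule imageE)
    moreover have "card (nbrs W {v}) \<le> Max ?D" if "v \<in> W" for v
      using fin that by (intro Max_ge) auto
    ultimately have x: "x \<in> W" "\<And>v. v \<in> W \<Longrightarrow> card (nbrs W {v}) \<le> card (nbrs W {x})" by simp_all
    define A where "A = nbrs W {x}"
    have AW: "A \<subseteq> W" and finA: "finite A" using fin nbrs_subset by (auto simp: A_def)
    have "cliques A (Suc r) {} = {}"
    proof (rule ccontr)
      assume "cliques A (Suc r) {} \<noteq> {}"
      then obtain K where K: "K \<in> cliques A (Suc r) {}" by auto
      then have "K \<in> cliques W (Suc r) {}" "x \<in> nbrs W K"
        using AW x by (auto simp: cliques_def A_def nbrs_def insert_commute)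
      then show False using insert_nbr_clique[OF fin] Suc.prems(2) by blast
    qed
    from Suc.IH[OF finA this] obtain c :: "'a \<Rightarrow> nat" where c: "\<forall>v\<in>A. c v < r"
      "\<forall>v\<in>A. card (nbrs A {v}) \<le> card {w \<in> A. c w \<noteq> c v}"
      "(\<forall>v\<in>A. card (nbrs A {v}) = card {w \<in> A. c w \<noteq> c v}) \<longrightarrow>
       (\<forall>u\<in>A. \<forall>v\<in>A. {u, v} \<in> E \<longleftrightarrow> c u \<noteq> c v)" by blast
    \<comment> \<open>The colours used on \<open>A\<close> are below \<open>r\<close>, so
      \<open>r\<close> is a fresh colour for \<open>W - A\<close>, the class containing
      \<open>x\<close>.\<close>
    define c' where "c' v = (if v \<in> A then c v else r)" for v
    have cB: "{w \<in> W. c' w \<noteq> c' v} = A" if "v \<in> W - A" for v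
      using that c(1) AW by (auto simp: c'_def)
    have cA: "card {w \<in> W. c' w \<noteq> c' v} = card {w \<in> A. c w \<noteq> c v} + card (W - A)" if "v \<in> A" for v
    proof -
      have "{w \<in> W. c' w \<noteq> c' v} = {w \<in> A. c w \<noteq> c v} \<union> (W - A)"
        using that c(1) AW by (auto simp: c'_def)
      moreover have "card ({w \<in> A. c w \<noteq> c v} \<union> (W - A)) = card {w \<in> A. c w \<noteq> c v} + card (W - A)"
        using fin finA by (intro card_Un_disjoint) auto
      ultimately show ?thesis by simp
    qed
    have nA: "card (nbrs W {v}) = card (nbrs A {v}) + card (nbrs (W - A) {v})" for v
    proof -
      have "nbrs W {v} = nbrs A {v} \<union> nbrs (W - A) {v}" using AW by (auto simp: nbrs_def)
      moreover have "card (nbrs A {v} \<union> nbrs (W - A) {v}) = card (nbrs A {v}) + card (nbrs (W - A) {v})"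
        using fin finA by (intro card_Un_disjoint) (auto simp: nbrs_def)
      ultimately show ?thesis by simp
    qed
    have nB: "card (nbrs (W - A) {v}) \<le> card (W - A)" for v
      using fin by (intro card_mono nbrs_subset) auto
    \<comment> \<open>Inside \<open>A\<close> the recursive bound grows by at most all of
      \<open>W - A\<close>. Outside \<open>A\<close> the colour degree is exactly
      \<open>card A\<close>, the maximum degree.\<close>
    have le: "card (nbrs W {v}) \<le> card {w \<in> W. c' w \<noteq> c' v}" if "v \<in> W" for v
    proof (cases "v \<in> A")
      case True
      then show ?thesis using cA nA[of v] nB[of v] c(2) by fastforce
    next
      case False
      then show ?thesis using x(2) that cB by (simp add: A_def)
    qed
    \<comment> \<open>Equality forces equality in both summands for vertices of \<open>A\<close>:
      the recursive bound is tight and each of them is joined to all of \<open>W - A\<close>. A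
      vertex of \<open>W - A\<close> then has \<open>A\<close> in its neighbourhood and degree
      \<open>card A\<close>, so no edge lies inside \<open>W - A\<close>.\<close>
    have ext: "{u, v} \<in> E \<longleftrightarrow> c' u \<noteq> c' v"
      if eq: "\<forall>v\<in>W. card (nbrs W {v}) = card {w \<in> W. c' w \<noteq> c' v}" and uv: "u \<in> W" "v \<in> W" for u v
    proof -
      have both: "card (nbrs A {v}) = card {w \<in> A. c w \<noteq> c v} \<and> card (nbrs (W - A) {v}) = card (W - A)"
        if "v \<in> A" for v
      proof -
        have "v \<in> W" using that AW by auto
        then show ?thesis using that cA nA[of v] nB[of v] c(2) eq by fastforce
      qed
      then have AA: "\<forall>u\<in>A. \<forall>v\<in>A. {u, v} \<in> E \<longleftrightarrow> c u \<noteq> c v" using c(3) by blast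
      have AB: "{u, v} \<in> E" if "u \<in> A" "v \<in> W - A" for u v
      proof -
        have "nbrs (W - A) {u} = W - A"
          using both that fin by (intro card_subset_eq nbrs_subset) auto
        then show ?thesis using that by (auto simp: nbrs_def)
      qed
      have BB: "{u, v} \<notin> E" if "u \<in> W - A" "v \<in> W - A" for u v
      proof -
        have "A \<subseteq> nbrs W {u}" using AB that AW by (auto simp: nbrs_def insert_commute)
        moreover have "card A = card (nbrs W {u})" using eq that cB by auto
        ultimately have "A = nbrs W {u}" using fin by (intro card_subset_eq) auto
        then show ?thesis using that by (auto simp: nbrs_def)
      qed
      have BA: "{u, v} \<in> E" if "v \<in> A" "u \<in> W - A" for u v
        using AB[OF that] by (simp add: insert_commute)
      show ?thesis using AA AB BA BB uv c(1) by (cases "u \<in> A"; cases "v \<in> A") (auto simp: c'_def)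
    qed
    have "\<forall>v\<in>W. c' v < Suc r" using c(1) by (auto simp: c'_def less_Suc_eq)
    then show ?thesis using le ext by blast
  qed simp
qed

lemma edges_le_remove_vertex:
  assumes fin: "finite W"
  shows "card (cliques W 2 {}) \<le> card (cliques (W - {v}) 2 {}) + card (nbrs W {v})"
proof -
  have "cliques W 2 {} \<subseteq> cliques (W - {v}) 2 {} \<union> (\<lambda>u. {v, u}) ` nbrs W {v}"
  proof
    fix e assume e: "e \<in> cliques W 2 {}"
    show "e \<in> cliques (W - {v}) 2 {} \<union> (\<lambda>u. {v, u}) ` nbrs W {v}"
    proof (cases "v \<in> e")
      case True
      then obtain u where "e = {v, u}" using cliques_2_edge(3)[OF e] by (auto simp: card_2_iff)
      then show ?thesis using cliques_2_edge[OF e] by (auto simp: nbrs_def)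
    next
      case False then show ?thesis using e by (auto simp: cliques_def)
    qed
  qed
  then have "card (cliques W 2 {}) \<le> card (cliques (W - {v}) 2 {} \<union> (\<lambda>u. {v, u}) ` nbrs W {v})"
    using fin by (intro card_mono) auto
  also have "\<dots> \<le> card (cliques (W - {v}) 2 {}) + card ((\<lambda>u. {v, u}) ` nbrs W {v})"
    by (rule card_Un_le)
  also have "\<dots> \<le> card (cliques (W - {v}) 2 {}) + card (nbrs W {v})"
    using fin by (intro add_left_mono card_image_le) auto
  finally show ?thesis .
qed

end

section \<open>Colour classes, the Turan number and isomorphism with the Turan graph\<close>

lemma sum_colour_degrees:
  fixes c :: "'a \<Rightarrow> nat"
  assumes fin: "finite W" and c: "\<forall>v\<in>W. c v < r"
  shows "(\<Sum>v\<in>W. real (card {w \<in> W. c w \<noteq> c v}))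
       = real (card W)^2 - (\<Sum>i<r. real (card {w \<in> W. c w = i})^2)"
proof -
  have "real (card {w \<in> W. c w \<noteq> c v}) = real (card W) - real (card {w \<in> W. c w = c v})" for v
  proof -
    have "card W = card ({w \<in> W. c w \<noteq> c v} \<union> {w \<in> W. c w = c v})"
      by (rule arg_cong[where f = card]) auto
    also have "\<dots> = card {w \<in> W. c w \<noteq> c v} + card {w \<in> W. c w = c v}"
      using fin by (intro card_Un_disjoint) auto
    finally show ?thesis by simp
  qed
  moreover have "(\<Sum>v\<in>W. real (card {w \<in> W. c w = c v})) = (\<Sum>i<r. real (card {w \<in> W. c w = i})^2)"
  proof -
    have "(\<Sum>v\<in>W. real (card {w \<in> W. c w = c v}))
        = (\<Sum>i<r. \<Sum>v\<in>{v \<in> W. c v = i}. real (card {w \<in> W. c w = c v}))"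
      using fin c by (intro sum.group[symmetric]) auto
    also have "\<dots> = (\<Sum>i<r. real (card {w \<in> W. c w = i})^2)"
      by (intro sum.cong refl) (simp add: power2_eq_square)
    finally show ?thesis .
  qed
  ultimately show ?thesis by (simp add: sum_subtractf power2_eq_square)
qed

lemma sum_colour_classes:
  fixes c :: "'a \<Rightarrow> nat"
  assumes fin: "finite W" and c: "\<forall>v\<in>W. c v < r"
  shows "(\<Sum>i<r. card {w \<in> W. c w = i}) = card W"
proof -
  have "(\<Sum>i<r. \<Sum>v\<in>{v \<in> W. c v = i}. (1::nat)) = (\<Sum>v\<in>W. 1)"
    using fin c by (intro sum.group) auto
  then show ?thesis by simp
qed

lemma card_residue_class:
  assumes "i < r"
  shows "card {w \<in> {0..<n}. w mod r = i} = n div r + (if i < n mod r then 1 else 0)"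
proof (induction n)
  case (Suc n)
  have "{w \<in> {0..<Suc n}. w mod r = i} =
     (if n mod r = i then insert n {w \<in> {0..<n}. w mod r = i} else {w \<in> {0..<n}. w mod r = i})"
    by (auto simp: less_Suc_eq)
  then show ?case using Suc assms by (auto simp: div_Suc mod_Suc)
qed simp

lemma loopless_turan: "loopless (turan_edges r n)"
proof
  fix v show "{v} \<notin> turan_edges r n" unfolding turan_edges_def by (auto simp: doubleton_eq_iff)
qed

lemma turan_edges_iff:
  "{u, v} \<in> turan_edges r n \<longleftrightarrow> u < n \<and> v < n \<and> u mod r \<noteq> v mod r"
  unfolding turan_edges_def by (auto simp: doubleton_eq_iff)

lemma turan_number_eq:
  assumes "r > 0"
  shows "2 * real (turan_number r n) = real n ^ 2 - (\<Sum>i<r. real (card {w \<in> {0..<n}. w mod r = i})^2)"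
proof -
  interpret T: loopless "turan_edges r n" by (rule loopless_turan)
  have "T.cliques {0..<n} 2 {} = turan_edges r n"
  proof (intro equalityI subsetI)
    fix e assume "e \<in> turan_edges r n"
    then obtain i j where e: "e = {i, j}" "i < n" "j < n" "i mod r \<noteq> j mod r"
      by (auto simp: turan_edges_def)
    then have "i \<noteq> j" by auto
    with e show "e \<in> T.cliques {0..<n} 2 {}"
      by (auto simp: T.cliques_def is_clique_def turan_edges_iff)
  qed (rule T.cliques_2_edge)
  then have "2 * real (turan_number r n) = (\<Sum>v\<in>{0..<n}. real (card (T.nbrs {0..<n} {v})))"
    using T.sum_degrees[of "{0..<n}"] by (simp add: turan_number_def)
  also have "\<dots> = (\<Sum>v\<in>{0..<n}. real (card {w \<in> {0..<n}. w mod r \<noteq> v mod r}))"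
  proof (rule sum.cong)
    fix v assume "v \<in> {0..<n}"
    then have "T.nbrs {0..<n} {v} = {w \<in> {0..<n}. w mod r \<noteq> v mod r}"
      by (auto simp: T.nbrs_def turan_edges_iff)
    then show "real (card (T.nbrs {0..<n} {v})) = real (card {w \<in> {0..<n}. w mod r \<noteq> v mod r})" by simp
  qed simp
  also have "\<dots> = real n ^ 2 - (\<Sum>i<r. real (card {w \<in> {0..<n}. w mod r = i})^2)"
    using sum_colour_degrees[of "{0..<n}" "\<lambda>w. w mod r" r] assms by simp
  finally show ?thesis .
qed

text \<open>Summing \<open>(a i - q) (a i - q - 1) \<ge> 0\<close>, where \<open>q = n div r\<close>, compares the squares of
  integer part sizes with the balanced ones.\<close>

lemma sum_squares_eq:
  fixes a :: "nat \<Rightarrow> nat"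
  assumes "(\<Sum>i<r. a i) = n"
  shows "(\<Sum>i<r. real (a i)^2) = (2 * real q + 1) * real n - real r * real q * (real q + 1)
     + (\<Sum>i<r. (real (a i) - real q) * (real (a i) - real q - 1))"
proof -
  have "(\<Sum>i<r. (real (a i) - real q) * (real (a i) - real q - 1))
      = (\<Sum>i<r. real (a i)^2 - (2 * real q + 1) * real (a i) + real q * (real q + 1))"
    by (intro sum.cong refl) (simp add: algebra_simps power2_eq_square)
  also have "\<dots> = (\<Sum>i<r. real (a i)^2) - (2 * real q + 1) * (\<Sum>i<r. real (a i)) + real r * (real q * (real q + 1))"
    by (simp add: sum.distrib sum_subtractf flip: sum_distrib_left)
  also have "(\<Sum>i<r. real (a i)) = real n" using assms by (simp flip: of_nat_sum)
  finally show ?thesis by simp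
qed

lemma nat_square_gap_nonneg: "(real a - real q) * (real a - real q - 1) \<ge> 0"
  by (cases "a \<le> q") (auto intro: mult_nonneg_nonneg mult_nonpos_nonpos)

text \<open>Residue classes have size \<open>q\<close> or \<open>q + 1\<close>, exactly the zeros of
  the gap term, so the identity for sums of squares loses its remainder.\<close>

lemma sum_squares_balanced:
  assumes "r > 0"
  shows "(\<Sum>i<r. real (card {w \<in> {0..<n}. w mod r = i})^2)
     = (2 * real (n div r) + 1) * real n - real r * real (n div r) * (real (n div r) + 1)"
proof -
  have "(\<Sum>i<r. card {w \<in> {0..<n}. w mod r = i}) = n"
    using sum_colour_classes[of "{0..<n}" "\<lambda>w. w mod r" r] assms by simp
  moreover have "(\<Sum>i<r. (real (card {w \<in> {0..<n}. w mod r = i}) - real (n div r)) *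
      (real (card {w \<in> {0..<n}. w mod r = i}) - real (n div r) - 1)) = 0"
    by (intro sum.neutral) (simp add: card_residue_class del: atLeastLessThan_iff)
  ultimately show ?thesis
    using sum_squares_eq[where r = r and a = "\<lambda>i. card {w \<in> {0..<n}. w mod r = i}" and n = n and q = "n div r"] by simp
qed

text \<open>Completing the square gives
  \<open>2 * t_r(n) = (1 - 1/r) n^2 - r/4 + r (n/r - q - 1/2)^2\<close>; this is where the deficit
  \<open>r/4\<close> comes from.\<close>

lemma turan_number_ge:
  assumes "r > 0"
  shows "(1 - 1 / real r) * real n ^ 2 - real r / 4 \<le> 2 * real (turan_number r n)"
proof -
  let ?q = "real (n div r)"
  have "0 \<le> (real n / real r - ?q - 1 / 2)\<^sup>2 * real r" by simp
  also have "\<dots> = real n ^ 2 / real r + real r / 4 - ((2 * ?q + 1) * real n - real r * ?q * (?q + 1))"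
    using assms by (simp add: power2_eq_square field_simps)
  finally show ?thesis
    using turan_number_eq[OF assms, of n] sum_squares_balanced[OF assms, of n]
    by (simp add: left_diff_distrib)
qed

text \<open>Bijections chosen class by class are glued. The isomorphism below needs this twice: on
  the \<open>r\<close> colours, split by whether the class is large, and then on the
  vertices.\<close>

lemma colour_preserving_bij:
  assumes fin: "finite V" "finite W" and c: "\<forall>v\<in>V. c v \<in> I" "\<forall>w\<in>W. d w \<in> I"
    and eq: "\<And>i. i \<in> I \<Longrightarrow> card {v \<in> V. c v = i} = card {w \<in> W. d w = i}"
  shows "\<exists>f. bij_betw f V W \<and> (\<forall>v\<in>V. d (f v) = c v)"
proof -
  have "\<exists>h. bij_betw h {v \<in> V. c v = i} {w \<in> W. d w = i}" if "i \<in> I" for i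
    using fin eq[OF that] by (intro finite_same_card_bij) auto
  then obtain h where h: "\<And>i. i \<in> I \<Longrightarrow> bij_betw (h i) {v \<in> V. c v = i} {w \<in> W. d w = i}"
    by metis
  define f where "f v = h (c v) v" for v
  have f: "f v \<in> W \<and> d (f v) = c v" if "v \<in> V" for v
    using bij_betwE[OF h[of "c v"]] c(1) that by (auto simp: f_def)
  have "inj_on f V"
  proof (rule inj_onI)
    fix u v assume uv: "u \<in> V" "v \<in> V" "f u = f v"
    then have "c u = c v" using f by metis
    then show "u = v" using uv h[of "c v"] c(1) by (auto simp: f_def bij_betw_def inj_on_def)
  qed
  moreover have "f ` V = W"
  proof (intro equalityI subsetI)
    fix w assume w: "w \<in> W"
    then have "w \<in> h (d w) ` {v \<in> V. c v = d w}"
      using h[of "d w"] c(2) by (auto simp: bij_betw_def)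
    then obtain v where "v \<in> V" "c v = d w" "w = h (d w) v" by auto
    then show "w \<in> f ` V" by (intro image_eqI[of _ _ v]) (simp_all add: f_def)
  qed (use f in auto)
  ultimately show ?thesis using f by (auto simp: bij_betw_def)
qed

lemma complete_multipartite_iso_turan:
  fixes c :: "'a \<Rightarrow> nat"
  assumes fin: "finite V" and n: "card V = n" and r: "r > 0" and c: "\<forall>v\<in>V. c v < r"
    and E: "\<forall>u\<in>V. \<forall>v\<in>V. {u, v} \<in> E \<longleftrightarrow> c u \<noteq> c v"
    and bal: "\<And>i. i < r \<Longrightarrow> card {v \<in> V. c v = i} \<in> {n div r, n div r + 1}"
  shows "graph_iso V E {0..<n} (turan_edges r n)"
proof -
  let ?a = "\<lambda>i. card {v \<in> V. c v = i}"
  define I where "I = {i. i < r \<and> ?a i = n div r + 1}"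
  have "n = (\<Sum>i<r. ?a i)" using sum_colour_classes[OF fin c] n by simp
  also have "\<dots> = (\<Sum>i<r. n div r + (if i \<in> I then 1 else 0))"
    using bal by (intro sum.cong) (auto simp: I_def)
  also have "\<dots> = r * (n div r) + card ({..<r} \<inter> I)"
    by (simp add: sum.distrib sum.If_cases)
  also have "{..<r} \<inter> I = I" by (auto simp: I_def)
  finally have cardI: "card I = card {..<n mod r}"
    by (metis add_left_cancel card_lessThan mult_div_mod_eq)
  have sub: "I \<subseteq> {..<r}" "{..<n mod r} \<subseteq> {..<r}" using r mod_less_divisor[of r n] by (auto simp: I_def)
  \<comment> \<open>In the Turan graph the parts of size \<open>q + 1\<close> are the residues below
    \<open>n mod r\<close>, while here the large classes form an arbitrary set \<open>I\<close> of
    the same size. The permutation \<pi> renames colours accordingly.\<close>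
  have "\<exists>\<pi>. bij_betw \<pi> {..<r} {..<r} \<and> (\<forall>i\<in>{..<r}. (\<pi> i < n mod r) = (i \<in> I))"
  proof (rule colour_preserving_bij[where I = UNIV])
    fix b :: bool
    have fI: "finite I" using sub finite_subset by blast
    have "{i \<in> {..<r}. i \<in> I} = I" "{i \<in> {..<r}. i \<notin> I} = {..<r} - I"
      "{i \<in> {..<r}. i < n mod r} = {..<n mod r}" "{i \<in> {..<r}. \<not> i < n mod r} = {..<r} - {..<n mod r}"
      using sub by auto
    then show "card {v \<in> {..<r}. (v \<in> I) = b} = card {w \<in> {..<r}. (w < n mod r) = b}"
      using cardI fI sub by (cases b) (simp_all add: card_Diff_subset)
  qed auto
  then obtain \<pi> where \<pi>: "bij_betw \<pi> {..<r} {..<r}" "\<And>i. i < r \<Longrightarrow> \<pi> i < n mod r \<longleftrightarrow> i \<in> I" by auto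
  have "\<exists>f. bij_betw f V {0..<n} \<and> (\<forall>v\<in>V. f v mod r = \<pi> (c v))"
  proof (rule colour_preserving_bij[where I = "{..<r}"])
    fix j assume "j \<in> {..<r}"
    then obtain i where i: "i < r" "j = \<pi> i" using \<pi>(1) by (auto simp: bij_betw_def)
    have "\<pi> (c v) = \<pi> i \<longleftrightarrow> c v = i" if "v \<in> V" for v
      using \<pi>(1) c that i by (auto simp: bij_betw_def inj_on_def)
    then have "{v \<in> V. \<pi> (c v) = j} = {v \<in> V. c v = i}" using i by auto
    moreover have "card {w \<in> {0..<n}. w mod r = j} = n div r + (if i \<in> I then 1 else 0)"
      using card_residue_class[of j r n] \<open>j \<in> {..<r}\<close> \<pi>(2)[OF i(1)] i by simp
    moreover have "?a i = n div r + (if i \<in> I then 1 else 0)"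
      using bal[OF i(1)] i by (auto simp: I_def)
    ultimately show "card {v \<in> V. \<pi> (c v) = j} = card {w \<in> {0..<n}. w mod r = j}" by simp
  qed (use fin c r bij_betwE[OF \<pi>(1)] in auto)
  then obtain f where f: "bij_betw f V {0..<n}" "\<And>v. v \<in> V \<Longrightarrow> f v mod r = \<pi> (c v)" by auto
  have "{u, v} \<in> E \<longleftrightarrow> {f u, f v} \<in> turan_edges r n" if uv: "u \<in> V" "v \<in> V" for u v
  proof -
    have "f u < n" "f v < n" using bij_betwE[OF f(1)] uv by auto
    moreover have "\<pi> (c u) = \<pi> (c v) \<longleftrightarrow> c u = c v"
      using \<pi>(1) c uv by (auto simp: bij_betw_def inj_on_def)
    ultimately show ?thesis using E uv f(2) by (simp add: turan_edges_iff)
  qed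
  then show ?thesis unfolding graph_iso_def using f(1) by blast
qed

context loopless
begin

text \<open>The degree sum is at least \<open>2 * t_r(n)\<close> and at most the colour degree sum,
  which is \<open>2 * t_r(n)\<close> minus the nonnegative gaps. Everything is therefore tight: zero
  gaps make the classes balanced, and equal degrees make the graph complete multipartite.\<close>

lemma turan_extremal:
  assumes fin: "finite V" and n: "card V = n" and r: "r > 0"
    and free: "cliques V (r + 1) {} = {}"
    and edges: "turan_number r n \<le> card (cliques V 2 {})"
  shows "graph_iso V E {0..<n} (turan_edges r n)"
proof -
  obtain c :: "'a \<Rightarrow> nat" where c: "\<forall>v\<in>V. c v < r"
    "\<forall>v\<in>V. card (nbrs V {v}) \<le> card {w \<in> V. c w \<noteq> c v}"
    "(\<forall>v\<in>V. card (nbrs V {v}) = card {w \<in> V. c w \<noteq> c v}) \<longrightarrow>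
       (\<forall>u\<in>V. \<forall>v\<in>V. {u, v} \<in> E \<longleftrightarrow> c u \<noteq> c v)"
    using degree_majorisation[OF fin, of r] free by auto
  let ?a = "\<lambda>i. card {v \<in> V. c v = i}"
  let ?q = "n div r"
  let ?gap = "\<lambda>i. (real (?a i) - real ?q) * (real (?a i) - real ?q - 1)"
  have "2 * real (turan_number r n) \<le> (\<Sum>v\<in>V. real (card (nbrs V {v})))"
    using edges by (simp add: sum_degrees[OF fin])
  moreover have le: "(\<Sum>v\<in>V. real (card (nbrs V {v}))) \<le> (\<Sum>v\<in>V. real (card {w \<in> V. c w \<noteq> c v}))"
    using c(2) by (intro sum_mono) auto
  moreover have "(\<Sum>v\<in>V. real (card {w \<in> V. c w \<noteq> c v})) = 2 * real (turan_number r n) - (\<Sum>i<r. ?gap i)"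
    using sum_colour_degrees[OF fin c(1)] turan_number_eq[OF r, of n] sum_squares_balanced[OF r, of n]
      sum_squares_eq[where r = r and a = ?a and n = n and q = ?q] sum_colour_classes[OF fin c(1)] n by simp
  moreover have gap: "0 \<le> (\<Sum>i<r. ?gap i)" by (intro sum_nonneg nat_square_gap_nonneg)
  ultimately have eqs: "(\<Sum>i<r. ?gap i) = 0"
    "(\<Sum>v\<in>V. real (card (nbrs V {v}))) = (\<Sum>v\<in>V. real (card {w \<in> V. c w \<noteq> c v}))"
    by linarith+
  have "\<forall>v\<in>V. card (nbrs V {v}) = card {w \<in> V. c w \<noteq> c v}"
  proof (rule ccontr)
    assume "\<not> ?thesis"
    then obtain v where "v \<in> V" "card (nbrs V {v}) < card {w \<in> V. c w \<noteq> c v}"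
      using c(2) by (auto simp: le_less)
    then have "(\<Sum>v\<in>V. real (card (nbrs V {v}))) < (\<Sum>v\<in>V. real (card {w \<in> V. c w \<noteq> c v}))"
      using fin c(2) by (intro sum_strict_mono_ex1) auto
    then show False using eqs(2) by simp
  qed
  then have E: "\<forall>u\<in>V. \<forall>v\<in>V. {u, v} \<in> E \<longleftrightarrow> c u \<noteq> c v" using c(3) by blast
  have "?a i \<in> {?q, ?q + 1}" if "i < r" for i
  proof -
    have "?gap i = 0"
      using eqs(1) that sum_nonneg_eq_0_iff[of "{..<r}" ?gap] nat_square_gap_nonneg by auto
    then have "real (?a i) = real ?q \<or> real (?a i) = real (?q + 1)" by auto
    then show ?thesis unfolding of_nat_eq_iff by simp
  qed
  then show ?thesis by (intro complete_multipartite_iso_turan[OF fin n r c(1) E])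
qed

section \<open>Deleting vertices of low degree\<close>

text \<open>Induction on the number \<open>k\<close> of deletions: either a stopping graph has
  appeared by now, or \<open>k\<close> deletions have each added at least \<open>n/r^4 - 1\<close>
  to the excess, which starts at no less than \<open>-r/4\<close>.\<close>

lemma low_degree_deletion:
  assumes fin: "finite V" and n: "card V = n" and r: "r \<ge> 2" and big: "n > r ^ 8"
    and edges: "(1 - 1 / real r) * real n ^ 2 - real r / 4 \<le> 2 * real (card (cliques V 2 {}))"
    and k: "k \<le> n div r"
  shows "(\<exists>W\<subseteq>V. (1 - 1 / real r) * real n \<le> real (card W) \<and>
        (\<forall>v\<in>W. (1 - 1 / real r - 1 / real r ^ 4) * real (card W) \<le> real (card (nbrs W {v}))) \<and>
        (W = V \<or> (1 - 1 / real r) * real (card W)^2 < 2 * real (card (cliques W 2 {})))) \<or>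
     (\<exists>W\<subseteq>V. card W = n - k \<and>
        (1 - 1 / real r) * real (card W)^2 - real r / 4 + real k * (real n / real r ^ 4 - 1)
          \<le> 2 * real (card (cliques W 2 {})))"
    (is "?early \<or> ?late k")
  using k
proof (induction k)
  case 0
  have "?late 0" using edges n by (intro exI[of _ V]) simp
  then show ?case by blast
next
  case (Suc k)
  show ?case
  proof (cases ?early)
    case False
    define N where "N = real n / real r ^ 4"
    have kn: "real (Suc k) \<le> real n / real r"
      using Suc.prems of_nat_mono[OF Suc.prems, where 'a = real] of_nat_div_le_of_nat[of n r, where ?'a = real] by linarith
    have "real n / real r \<le> real n / 2" using r by (intro divide_left_mono) auto
    with kn have kn2: "real (Suc k) \<le> real n / 2" by linarith
    have N: "N > real r ^ 4"
    proof -
      have "real r ^ 8 < real n" using big by (metis of_nat_less_iff of_nat_power)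
      then have "real r ^ 4 * real r ^ 4 < real n" by (simp flip: power_add)
      then show ?thesis using r by (simp add: N_def field_simps)
    qed
    have r4: "real r \<le> real r ^ 4" using r by (intro self_le_power) auto
    have "2 \<le> real r" using r by simp
    then have N1: "1 \<le> N" "real r < N" using N r4 by linarith+
    from False Suc obtain W where W: "W \<subseteq> V" "card W = n - k"
      "(1 - 1 / real r) * real (card W)^2 - real r / 4 + real k * (N - 1) \<le> 2 * real (card (cliques W 2 {}))"
      unfolding N_def by auto
    have finW: "finite W" using W fin finite_subset by blast
    have m: "real (card W) = real n - real k" using W kn2 by (simp add: of_nat_diff)
    have "\<not> (\<forall>v\<in>W. (1 - 1 / real r - 1 / real r ^ 4) * real (card W) \<le> real (card (nbrs W {v})))"
    proof
      assume "\<forall>v\<in>W. (1 - 1 / real r - 1 / real r ^ 4) * real (card W) \<le> real (card (nbrs W {v}))"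
      moreover have "(1 - 1 / real r) * real n \<le> real (card W)"
        using m kn by (simp add: left_diff_distrib)
      moreover have "W = V \<or> (1 - 1 / real r) * real (card W)^2 < 2 * real (card (cliques W 2 {}))"
      \<comment> \<open>Without a deletion the excess may be negative, whence the alternative
        \<open>W = V\<close>. From \<open>k = 1\<close> on, a single gain \<open>N - 1\<close>
        exceeds \<open>r/4\<close>.\<close>
      proof (cases "k = 0")
        case True then show ?thesis using W n fin card_subset_eq[of V W] by simp
      next
        case False
        have "1 * (N - 1) \<le> real k * (N - 1)"
          using False N1 by (intro mult_right_mono) auto
        moreover have "real r / 4 < 1 * (N - 1)" using N1 \<open>2 \<le> real r\<close> by simp
        ultimately have "real r / 4 < real k * (N - 1)" by (rule less_le_trans[rotated])
        then show ?thesis using W(3) by linarith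
      qed
      ultimately show False using \<open>\<not> ?early\<close> W(1) by blast
    qed
    then obtain v where v: "v \<in> W" "real (card (nbrs W {v})) < (1 - 1 / real r - 1 / real r ^ 4) * real (card W)"
      by fastforce
    have card': "card (W - {v}) = n - Suc k" using W v finW by simp
    have m': "real (card (W - {v})) = real (card W) - 1" using v finW
      by (metis One_nat_def Suc_leI card_Diff_singleton card_gt_0_iff empty_iff of_nat_1 of_nat_diff)
    have "2 * real (card W) / real r ^ 4 \<ge> N"
    proof -
      have "real n \<le> 2 * real (card W)" using m kn2 by simp
      then show ?thesis unfolding N_def by (intro divide_right_mono) auto
    qed
    moreover have "real (card (cliques W 2 {})) \<le> real (card (cliques (W - {v}) 2 {})) + real (card (nbrs W {v}))"
      using edges_le_remove_vertex[OF finW, of v] by (simp flip: of_nat_add)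
    \<comment> \<open>The reference value drops by \<open>(1 - 1/r)(2m - 1)\<close> and twice the
      edge count by less than \<open>2 (1 - 1/r - 1/r^4) m\<close>. The gain exceeds
      \<open>2m/r^4 - (1 - 1/r)\<close>, hence \<open>N - 1\<close>, because
      \<open>m \<ge> n/2\<close>.\<close>
    moreover have "(1 - 1 / real r) * real (card (W - {v}))^2
        = (1 - 1 / real r) * real (card W)^2 - 2 * ((1 - 1 / real r) * real (card W)) + (1 - 1 / real r)"
      unfolding m' by (simp add: power2_eq_square algebra_simps)
    moreover have "2 * real (card W) / real r ^ 4
        = 2 * ((1 - 1 / real r) * real (card W)) - 2 * ((1 - 1 / real r - 1 / real r ^ 4) * real (card W))"
      by (simp add: algebra_simps)
    moreover have "real (Suc k) * (N - 1) = real k * (N - 1) + N - 1" by (simp add: algebra_simps)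
    moreover have "0 \<le> 1 / real r" by simp
    ultimately have "(1 - 1 / real r) * real (card (W - {v}))^2 - real r / 4 + real (Suc k) * (N - 1)
        \<le> 2 * real (card (cliques (W - {v}) 2 {}))"
      using W(3) v(2) by linarith
    then have "?late (Suc k)" unfolding N_def using W(1) card' by (intro exI[of _ "W - {v}"]) auto
    then show ?thesis by blast
  qed blast
qed

text \<open>Both outcomes of the deletion leave a set \<open>W\<close> of at least
  \<open>(1 - 1/r) n\<close> vertices, and the cliques found in \<open>W\<close> are cliques in
  \<open>V\<close>. Only the constants differ.\<close>

lemma edge_in_many_cliques:
  assumes fin: "finite V" and n: "card V = n" and r: "r \<ge> 2" and big: "n > r ^ 8"
    and edges: "turan_number r n \<le> card (cliques V 2 {})"
    and not_turan: "\<not> graph_iso V E {0..<n} (turan_edges r n)"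
  shows "\<exists>e\<in>cliques V 2 {}. real n ^ (r - 1) / real r ^ (r + 5) < real (card (cliques V (r + 1) e))"
proof -
  define x where "x = real r"
  have x: "x \<ge> 2" using r by (simp add: x_def)
  have n0: "real n > 0" using big by simp
  have "(1 - 1 / real r) * real n ^ 2 - real r / 4 \<le> 2 * real (card (cliques V 2 {}))"
    using turan_number_ge[of r n] edges r by simp
  from low_degree_deletion[OF fin n r big this order_refl] show ?thesis
  proof (rule disjE, goal_cases)
    case 1
    then obtain W where W: "W \<subseteq> V" "(1 - 1 / real r) * real n \<le> real (card W)"
      and deg: "\<forall>v\<in>W. (1 - 1 / real r - 1 / real r ^ 4) * real (card W) \<le> real (card (nbrs W {v}))"
      and alt: "W = V \<or> (1 - 1 / real r) * real (card W)^2 < 2 * real (card (cliques W 2 {}))"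
      by blast
    have finW: "finite W" using W fin finite_subset by blast
    have "cliques W (r + 1) {} \<noteq> {}"
      using alt exists_clique_if_many_edges[OF finW r] turan_extremal[OF fin n _ _ edges] not_turan r by auto
    from min_degree_edge_in_many_cliques[OF finW r this] deg obtain e where e: "e \<in> cliques W 2 {}"
      "real (card W) ^ (r - 1) \<le> real r ^ (r + 1) * real (r + 1) * real (card (cliques W (r + 1) e))"
      by auto
    let ?N = "real (card (cliques V (r + 1) e))"
    have "card (cliques W (r + 1) e) \<le> card (cliques V (r + 1) e)"
      using fin W(1) by (intro card_mono cliques_mono) auto
    then have "real r ^ (r + 1) * real (r + 1) * real (card (cliques W (r + 1) e)) \<le> real r ^ (r + 1) * real (r + 1) * ?N"
      by (intro mult_left_mono) auto
    with e(2) have "real (card W) ^ (r - 1) \<le> x ^ (r + 1) * (x + 1) * ?N" by (simp add: x_def add.commute)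
    then have "x * real (card W) ^ (r - 1) \<le> x * (x ^ (r + 1) * (x + 1) * ?N)"
      using x by (intro mult_left_mono) auto
    then have le: "real n ^ (r - 1) \<le> x ^ (r + 2) * (x + 1) * ?N"
      using bernoulli_power_ge[OF r W(2)] by (simp add: x_def algebra_simps)
    moreover have "0 < real n ^ (r - 1)" using n0 by simp
    ultimately have "0 < x ^ (r + 2) * (x + 1) * ?N" by linarith
    \<comment> \<open>Positivity of the count carries the strict inequality
      \<open>x + 1 < x^3\<close> between constants over to the products.\<close>
    then have N: "?N > 0" using x by (simp add: zero_less_mult_iff)
    have "2 * 2 \<le> x * x" using x by (intro mult_mono) auto
    then have "x * 4 \<le> x * (x * x)" using x by (intro mult_left_mono) auto
    moreover have "x ^ 3 = x * (x * x)" by (simp add: power_numeral_reduce)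
    ultimately have "x + 1 < x ^ 3" using x by linarith
    then have "x ^ (r + 2) * (x + 1) * ?N < x ^ (r + 2) * x ^ 3 * ?N"
      using x N by (intro mult_strict_right_mono mult_strict_left_mono) auto
    moreover have "x ^ (r + 5) = x ^ (r + 2) * x ^ 3" by (simp add: power_add power_numeral_reduce)
    ultimately have "real n ^ (r - 1) < x ^ (r + 5) * ?N" using le by simp
    then have "real n ^ (r - 1) / real r ^ (r + 5) < ?N"
      using x by (simp add: x_def divide_less_eq mult.commute)
    then show ?thesis using e(1) cliques_mono[OF W(1)] by blast
  next
    case 2
    then obtain W where W: "W \<subseteq> V" "card W = n - n div r"
      and ex: "(1 - 1 / real r) * real (card W)^2 - real r / 4 + real (n div r) * (real n / real r ^ 4 - 1)
          \<le> 2 * real (card (cliques W 2 {}))"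
      by blast
    have finW: "finite W" using W fin finite_subset by blast
    define N where "N = real n / x ^ 4"
    have nN: "real n = N * x ^ 4" using x by (simp add: N_def)
    have N: "N > x ^ 4"
    proof -
      have "x ^ 8 < real n" using big unfolding x_def by (metis of_nat_less_iff of_nat_power)
      then have "x ^ 4 * x ^ 4 < real n" by (simp flip: power_add)
      then show ?thesis using x by (simp add: N_def field_simps)
    qed
    have x4: "16 \<le> x ^ 4" using x power_mono[of 2 x 4] by simp
    have x3: "8 \<le> x ^ 3" using x power_mono[of 2 x 3] by simp
    have xx4: "x \<le> x ^ 4" using x by (intro self_le_power) auto
    have mW: "(1 - 1 / real r) * real n \<le> real (card W)"
      using W(2) of_nat_div_le_of_nat[of n r, where ?'a = real] by (simp add: of_nat_diff left_diff_distrib)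
    have mn: "real (card W) \<le> real n" using W(2) by simp
    have W0: "W \<noteq> {}"
    proof -
      have "0 < (1 - 1 / real r) * real n" using n0 r by (intro mult_pos_pos) auto
      then show ?thesis using mW by auto
    qed
    \<comment> \<open>Half of the expected excess \<open>n^2/r^5\<close>. The other half pays for
      rounding in \<open>n div r\<close>, for the \<open>-1\<close> in each gain and for
      \<open>r/4\<close>.\<close>
    define \<eta> where "\<eta> = 1 / (2 * x ^ 5)"
    have \<eta>: "0 < \<eta>" "\<eta> \<le> 1 / real r"
    proof -
      show "0 < \<eta>" using x by (simp add: \<eta>_def)
      have "x \<le> x ^ 5" using x by (intro self_le_power) auto
      then have "\<eta> \<le> 1 / x" using x unfolding \<eta>_def by (intro divide_left_mono) auto
      then show "\<eta> \<le> 1 / real r" by (simp add: x_def)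
    qed
    have "\<eta> * real (card W)^2 \<le> real (n div r) * (N - 1) - x / 4"
    proof -
      have "\<eta> * real (card W)^2 \<le> \<eta> * real n ^ 2" using \<eta> mn by (intro mult_left_mono power_mono) auto
      also have "\<dots> = N * N * x ^ 3 / 2" using x
        by (simp add: \<eta>_def nN power_mult_distrib field_simps flip: power_add) (simp add: power2_eq_square power_numeral_reduce)
      also have "\<dots> \<le> (N * x ^ 3 - 1) * (N - 1) - x / 4"
      \<comment> \<open>Here \<open>N * x^3 = n/r\<close>. Half of \<open>N * N * x^3\<close> must
        cover \<open>N * x^3 + N + x/4\<close>; since \<open>N > 16\<close> and
        \<open>x^3 \<ge> 8\<close>, the first two terms take at most 1/16 and 1/128 of
        \<open>N * N * x^3\<close>.\<close>
      proof -
        have "16 * (N * x ^ 3) \<le> N * (N * x ^ 3)" using N x4 x by (intro mult_right_mono) auto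
        moreover have "8 * N \<le> x ^ 3 * N" using N x4 x3 by (intro mult_right_mono) auto
        moreover have "(N * x ^ 3 - 1) * (N - 1) = N * (N * x ^ 3) - N * x ^ 3 - N + 1" by (simp add: algebra_simps)
        moreover have "N * N * x ^ 3 = N * (N * x ^ 3)" "x ^ 3 * N = N * x ^ 3" by simp_all
        ultimately show ?thesis using N xx4 x by linarith
      qed
      also have "(N * x ^ 3 - 1) * (N - 1) \<le> real (n div r) * (N - 1)"
      proof (rule mult_right_mono)
        have "real n / real r = N * x ^ 3" using x nN by (simp add: x_def[symmetric] power_numeral_reduce)
        moreover have "real (n mod r) / real r \<le> 1" using r by (simp add: divide_le_eq less_imp_le)
        ultimately show "N * x ^ 3 - 1 \<le> real (n div r)"
          using of_nat_of_nat_div_aux[of n r, where ?'a = real] by linarith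
        show "0 \<le> N - 1" using N x4 by linarith
      qed
      finally show ?thesis by simp
    qed
    then have "(1 - 1 / real r + \<eta>) * real (card W)^2 \<le> 2 * real (card (cliques W 2 {}))"
      using ex by (simp add: distrib_right N_def x_def)
    from dense_edge_in_many_cliques[OF finW W0 r \<eta> this] obtain e where e: "e \<in> cliques W 2 {}"
      "real r * \<eta> * real (card W) ^ (r - 1) \<le> real (r - 1) * real r ^ (r - 2) * real (card (cliques W (r + 1) e))"
      by auto
    let ?N = "real (card (cliques V (r + 1) e))"
    have "card (cliques W (r + 1) e) \<le> card (cliques V (r + 1) e)"
      using fin W(1) by (intro card_mono cliques_mono) auto
    then have "real (r - 1) * real r ^ (r - 2) * real (card (cliques W (r + 1) e)) \<le> real (r - 1) * real r ^ (r - 2) * ?N"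
      by (intro mult_left_mono) auto
    with e(2) have "real r * \<eta> * real (card W) ^ (r - 1) \<le> real (r - 1) * real r ^ (r - 2) * ?N"
      by (rule order_trans)
    then have "\<eta> * (x * real (card W) ^ (r - 1)) \<le> (x - 1) * x ^ (r - 2) * ?N"
      using r by (simp add: x_def of_nat_diff mult_ac)
    moreover have "\<eta> * real n ^ (r - 1) \<le> \<eta> * (x * real (card W) ^ (r - 1))"
      using bernoulli_power_ge[OF r mW] \<eta> unfolding x_def by (intro mult_left_mono) auto
    ultimately have "\<eta> * real n ^ (r - 1) \<le> (x - 1) * x ^ (r - 2) * ?N" by linarith
    then have "2 * x ^ 5 * (\<eta> * real n ^ (r - 1)) \<le> 2 * x ^ 5 * ((x - 1) * x ^ (r - 2) * ?N)"
      using x by (intro mult_left_mono) auto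
    moreover have "2 * x ^ 5 * \<eta> = 1" using x by (simp add: \<eta>_def)
    moreover have "2 * x ^ 5 * ((x - 1) * x ^ (r - 2) * ?N) = (2 * (x - 1)) * x ^ (r + 3) * ?N"
    proof -
      have "r + 3 = 5 + (r - 2)" using r by simp
      then have "x ^ (r + 3) = x ^ 5 * x ^ (r - 2)" by (metis power_add)
      then show ?thesis by simp
    qed
    ultimately have le: "real n ^ (r - 1) \<le> (2 * (x - 1)) * x ^ (r + 3) * ?N"
      by (simp only: mult.assoc[symmetric])
    moreover have "0 < real n ^ (r - 1)" using n0 by simp
    ultimately have "0 < (2 * (x - 1)) * x ^ (r + 3) * ?N" by linarith
    then have N0: "?N > 0" using x by (simp add: zero_less_mult_iff)
    have "0 \<le> (x - 1)\<^sup>2" by simp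
    then have "2 * (x - 1) < x ^ 2" by (simp add: power2_eq_square algebra_simps)
    then have "(2 * (x - 1)) * x ^ (r + 3) * ?N < x ^ 2 * x ^ (r + 3) * ?N"
      using x N0 by (intro mult_strict_right_mono) auto
    moreover have "x ^ (r + 5) = x ^ 2 * x ^ (r + 3)" by (simp add: power_add power_numeral_reduce)
    ultimately have "real n ^ (r - 1) < x ^ (r + 5) * ?N" using le by simp
    then have "real n ^ (r - 1) / real r ^ (r + 5) < ?N"
      using x by (simp add: x_def divide_less_eq mult.commute)
    then show ?thesis using e(1) cliques_mono[OF W(1)] by blast
  qed
qed

end

section \<open>From an edge in many cliques to the maximum over all edges\<close>

theorem theorem7:
  fixes V :: "'a set" and E :: "'a set set" and r n :: nat
  assumes "simple_graph V E"
    and "card V = n"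
    and "r \<ge> 2"
    and "n > r ^ 8"
    and "card E \<ge> turan_number r n"
    and "\<not> graph_iso V E {0..<n} (turan_edges r n)"
  shows "real (js_edge V E r) > real n ^ (r - 1) / real r ^ (r + 5)"
proof -
  have fin: "finite V" and E: "\<And>e. e \<in> E \<Longrightarrow> \<exists>u v. u \<noteq> v \<and> u \<in> V \<and> v \<in> V \<and> e = {u, v}"
    using assms(1) by (auto simp: simple_graph_def)
  interpret loopless E
  proof
    fix v show "{v} \<notin> E" using E[of "{v}"] by (auto simp: doubleton_eq_iff)
  qed
  \<comment> \<open>Identifying edges with 2-cliques lets the hypothesis on \<open>card E\<close>
    feed the clique counts.\<close>
  have "cliques V 2 {} = E"
  proof (intro equalityI subsetI)
    fix e assume e: "e \<in> E"
    with E obtain u v where "u \<noteq> v" "u \<in> V" "v \<in> V" "e = {u, v}" by blast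
    with e show "e \<in> cliques V 2 {}" by (auto simp: cliques_def is_clique_def insert_commute)
  qed (rule cliques_2_edge)
  then obtain e where e: "e \<in> E" "real n ^ (r - 1) / real r ^ (r + 5) < real (card (cliques V (r + 1) e))"
    using edge_in_many_cliques[OF fin assms(2-4) _ assms(6)] assms(5) by auto
  have "finite E" using \<open>cliques V 2 {} = E\<close> finite_cliques[OF fin] by metis
  then have "cliques_containing V E (r + 1) e \<le> js_edge V E r"
    using e(1) by (auto simp: js_edge_def)
  then show ?thesis using e(2) unfolding cliques_containing_eq by simp
qed

end
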